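(* Let $P$ be a set of $n$ points in $\mathbb{R}^3$, let $\Delta=abc$ be a fixed given triangle, and let $S_\Delta(P)$ denote the number of triangles spanned by $P$ (i.e., with all three vertices in $P$) that are similar to $\Delta$. Then $$ S_\Delta(P)=O(n^{15/7}). $$
   Context: The constant of proportionality is absolute (it does not depend on $P$, $n$, or $\Delta$). *)

theory Defs
  imports "HOL-Analysis.Analysis"
begin

text \<open>A triangle is identified with the set of its three vertices, which are required not to lie
  on a common line (so they are automatically distinct).  In particular a triangle is counted once,
  irrespective of the order of its vertices and of the number of symmetries it has.\<close>

definition is_triangle :: "'a::euclidean_space set \<Rightarrow> bool" where
  "is_triangle T \<longleftrightarrow> (\<exists>p q r. T = {p, q, r} \<and> \<not> collinear {p, q, r})"

definition similarity :: "('a::euclidean_space \<Rightarrow> 'a) \<Rightarrow> bool" where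
  "similarity f \<longleftrightarrow> (\<exists>s>0. \<forall>x y. dist (f x) (f y) = s * dist x y)"

definition similar :: "'a::euclidean_space set \<Rightarrow> 'a set \<Rightarrow> bool" where
  "similar S T \<longleftrightarrow> (\<exists>f. similarity f \<and> f ` S = T)"

definition num_similar_triangles :: "'a::euclidean_space set \<Rightarrow> 'a set \<Rightarrow> nat" where
  "num_similar_triangles \<Delta> P = card {T. T \<subseteq> P \<and> is_triangle T \<and> similar \<Delta> T}"

end

theory Submission
  imports Defs "Jordan_Normal_Form.Determinant"
begin

text \<open>Let \<open>|P| = n\<close>.  Fixing two vertices \<open>p, q\<close> of a similar copy confines the third one to a circle
  with axis \<open>pq\<close>, so it suffices to count incidences of the points with these \<open>n\<^sup>2\<close> circles.
  Take a nonzero polynomial \<open>F\<close> of degree \<open>k = O(n powr (1/7))\<close> such that every component of the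
  complement of its zero set \<open>Z\<close> contains \<open>O(n powr (4/7))\<close> points.

  A circle not contained in \<open>Z\<close> is cut by \<open>Z\<close> into \<open>O(k)\<close> points and arcs.  At most two points on
  every arc cost \<open>O(n\<^sup>2 k)\<close> in total; further points give triples within one component, and three
  points lie on at most two of the circles.  For a circle contained in \<open>Z\<close> consider the sphere around
  \<open>p\<close> through it.  If \<open>Z\<close> does not contain this sphere, it contains at most \<open>k\<close> circles of it,
  and circles around the same \<open>p\<close> on the same sphere share at most two points; summing over the spheres
  around \<open>p\<close> gives \<open>O(n k)\<close> for every \<open>p\<close>.  Finally \<open>Z\<close> contains at most \<open>k / 2\<close> spheres, each
  of which contributes at most \<open>n\<^sup>2\<close>.

  Polynomial partitioning does not need Borsuk--Ulam: a polynomial through one random point of each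
  of \<open>m\<close> given sets splits, on average, at least half of them into parts of proportion at most 7/8, which is
  enough for an iteration whose degrees add up geometrically.\<close>

section \<open>Tournaments and determinants with one free row\<close>

lemma tournament_few_lopsided:
  fixes s :: "'b \<Rightarrow> 'b \<Rightarrow> 'a::linordered_idom"
  assumes fin: "finite S" and anti: "\<And>x y. x \<in> S \<Longrightarrow> y \<in> S \<Longrightarrow> s x y = - s y x"
  shows "4 * card {x \<in> S. 7 * card S < 8 * card {y \<in> S. 0 < s x y}} \<le> card S"
proof -
  define A where "A = {x \<in> S. 7 * card S < 8 * card {y \<in> S. 0 < s x y}}"
  define arcs where "arcs = (SIGMA x:A. {y \<in> A. 0 < s x y})"
  have AS: "A \<subseteq> S" and finA: "finite A"
    using fin by (auto simp: A_def)
  have disj: "arcs \<inter> prod.swap ` arcs = {}"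
  proof -
    have False if "(x, y) \<in> arcs" "(y, x) \<in> arcs" for x y
      using that anti[of x y] AS by (auto simp: arcs_def)
    then show ?thesis by auto
  qed
  have finarcs: "finite arcs"
    using finA by (auto simp: arcs_def)
  have "card arcs + card (prod.swap ` arcs) = card (arcs \<union> prod.swap ` arcs)"
    using disj finarcs by (subst card_Un_disjoint) auto
  also have "\<dots> \<le> card (A \<times> A)"
    by (rule card_mono) (use finA in \<open>auto simp: arcs_def\<close>)
  finally have arcs_le: "2 * card arcs \<le> card A * card A"
    by (simp add: card_image card_cartesian_product)
  have arcs_sum: "card arcs = (\<Sum>x\<in>A. card {y \<in> A. 0 < s x y})"
    unfolding arcs_def using finA by (subst card_SigmaI) auto
  have deg: "card {y \<in> S. 0 < s x y} \<le> (card S - card A) + card {y \<in> A. 0 < s x y}" for x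
  proof -
    have "card {y \<in> S. 0 < s x y} \<le> card ((S - A) \<union> {y \<in> A. 0 < s x y})"
      by (rule card_mono) (use fin finA in auto)
    also have "\<dots> \<le> card (S - A) + card {y \<in> A. 0 < s x y}"
      by (rule card_Un_le)
    also have "card (S - A) = card S - card A"
      using AS fin by (simp add: card_Diff_subset finA)
    finally show ?thesis .
  qed
  have "card A * (7 * card S) \<le> (\<Sum>x\<in>A. 8 * card {y \<in> S. 0 < s x y})"
  proof -
    have "(\<Sum>x\<in>A. 7 * card S) \<le> (\<Sum>x\<in>A. 8 * card {y \<in> S. 0 < s x y})"
      by (rule sum_mono) (auto simp: A_def)
    then show ?thesis by simp
  qed
  also have "\<dots> \<le> (\<Sum>x\<in>A. 8 * ((card S - card A) + card {y \<in> A. 0 < s x y}))"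
    by (intro sum_mono mult_left_mono deg) auto
  also have "\<dots> = 8 * (card A * (card S - card A)) + 8 * card arcs"
    by (simp add: arcs_sum sum.distrib sum_distrib_left distrib_left)
  also have "\<dots> \<le> 8 * (card A * (card S - card A)) + 4 * (card A * card A)"
    using arcs_le by linarith
  finally have "card A * (7 * card S) \<le> card A * (8 * (card S - card A) + 4 * card A)"
    by (simp add: algebra_simps)
  then have "card A = 0 \<or> 7 * card S \<le> 8 * (card S - card A) + 4 * card A"
    by (auto simp only: mult_le_cancel1)
  moreover have "card A \<le> card S"
    using AS fin by (rule card_mono[rotated])
  ultimately have "4 * card A \<le> card S"
    by linarith
  then show ?thesis by (simp add: A_def)
qed

lemma tournament_half_balanced:
  fixes s :: "'b \<Rightarrow> 'b \<Rightarrow> 'a::linordered_idom"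
  assumes fin: "finite S" and anti: "\<And>x y. x \<in> S \<Longrightarrow> y \<in> S \<Longrightarrow> s x y = - s y x"
  shows "2 * card {x \<in> S. 7 * card S < 8 * card {y \<in> S. 0 < s x y} \<or>
    7 * card S < 8 * card {y \<in> S. s x y < 0}} \<le> card S"
proof -
  have "4 * card {x \<in> S. 7 * card S < 8 * card {y \<in> S. 0 < s x y}} \<le> card S"
    by (rule tournament_few_lopsided[OF assms])
  moreover have "4 * card {x \<in> S. 7 * card S < 8 * card {y \<in> S. 0 < - s x y}} \<le> card S"
    by (rule tournament_few_lopsided[OF fin]) (subst anti, assumption+, rule refl)
  moreover have "card {x \<in> S. 7 * card S < 8 * card {y \<in> S. 0 < s x y} \<or>
      7 * card S < 8 * card {y \<in> S. s x y < 0}}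
    \<le> card {x \<in> S. 7 * card S < 8 * card {y \<in> S. 0 < s x y}}
      + card {x \<in> S. 7 * card S < 8 * card {y \<in> S. 0 < - s x y}}"
    unfolding Collect_disj_eq conj_disj_distribL using card_Un_le by simp
  ultimately show ?thesis by linarith
qed

lemma PiE_card_slicewise:
  assumes "finite I" "i \<in> I" "\<And>j. j \<in> I \<Longrightarrow> finite (S j)"
    and slice: "\<And>g. g \<in> PiE (I - {i}) S \<Longrightarrow> 2 * card {s \<in> S i. Q (g(i := s))} \<le> card (S i)"
  shows "2 * card {x \<in> PiE I S. Q x} \<le> card (PiE I S)"
proof -
  let ?R = "PiE (I - {i}) S"
  have I: "I = insert i (I - {i})" using assms by auto
  have finR: "finite ?R" using assms by (intro finite_PiE) auto
  let ?f = "\<lambda>(g, s). g(i := s)"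
  have inj: "inj_on ?f (?R \<times> S i)"
  proof (rule inj_onI, clarify)
    fix g s g' s'
    assume *: "g \<in> ?R" "g' \<in> ?R" and eq: "g(i := s) = g'(i := s')"
    have "g j = g' j" for j
      using fun_cong[OF eq, of j] * by (cases "j = i") (auto simp: PiE_def extensional_def)
    then show "g = g' \<and> s = s'"
      using fun_cong[OF eq, of i] by auto
  qed
  have PiE_eq: "PiE I S = ?f ` (?R \<times> S i)"
    by (subst I, subst PiE_insert_eq) auto
  have "{x \<in> PiE I S. Q x} = ?f ` (SIGMA g:?R. {s \<in> S i. Q (g(i := s))})"
    unfolding PiE_eq by auto
  then have "card {x \<in> PiE I S. Q x} = card (SIGMA g:?R. {s \<in> S i. Q (g(i := s))})"
    by (simp only:) (rule card_image, rule inj_on_subset[OF inj], auto)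
  also have "\<dots> = (\<Sum>g\<in>?R. card {s \<in> S i. Q (g(i := s))})"
    using finR assms by (subst card_SigmaI) auto
  finally have "2 * card {x \<in> PiE I S. Q x} = (\<Sum>g\<in>?R. 2 * card {s \<in> S i. Q (g(i := s))})"
    by (simp add: sum_distrib_left)
  also have "\<dots> \<le> (\<Sum>g\<in>?R. card (S i))" by (rule sum_mono) (rule slice)
  also have "\<dots> = card (PiE I S)"
    unfolding PiE_eq by (simp add: card_image[OF inj] card_cartesian_product)
  finally show ?thesis .
qed

definition bordered :: "nat \<Rightarrow> (nat \<Rightarrow> nat \<Rightarrow> 'a) \<Rightarrow> (nat \<Rightarrow> 'a) \<Rightarrow> 'a mat" where
  "bordered M r z = Matrix.mat (Suc M) (Suc M) (\<lambda>(i, k). if i < M then r i k else z k)"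

lemma bordered_carrier [simp]: "bordered M r z \<in> carrier_mat (Suc M) (Suc M)"
  by (simp add: bordered_def)

lemma det_bordered_linear:
  fixes r :: "nat \<Rightarrow> nat \<Rightarrow> 'a::comm_ring_1"
  obtains c where "\<And>z. Determinant.det (bordered M r z) = (\<Sum>k\<le>M. z k * c k)"
proof
  fix z
  have "mat_delete (bordered M r z) M k = mat_delete (bordered M r (\<lambda>_. 0)) M k" for k
    by (rule eq_matI) (auto simp: mat_delete_def bordered_def)
  then have "cofactor (bordered M r z) M k = cofactor (bordered M r (\<lambda>_. 0)) M k" for k
    by (simp add: cofactor_def)
  moreover have "Determinant.det (bordered M r z)
      = (\<Sum>k<Suc M. bordered M r z $$ (M, k) * cofactor (bordered M r z) M k)"
    by (rule laplace_expansion_row) auto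
  ultimately show "Determinant.det (bordered M r z)
      = (\<Sum>k\<le>M. z k * cofactor (bordered M r (\<lambda>_. 0)) M k)"
    by (simp add: bordered_def lessThan_Suc_atMost)
qed

lemma det_bordered_swap:
  fixes V :: "'b \<Rightarrow> nat \<Rightarrow> 'a::comm_ring_1"
  assumes "i < M"
  shows "Determinant.det (bordered M (\<lambda>j. V ((x(i := s)) j)) (V t))
    = - Determinant.det (bordered M (\<lambda>j. V ((x(i := t)) j)) (V s))"
proof -
  have "bordered M (\<lambda>j. V ((x(i := s)) j)) (V t)
      = swaprows i M (bordered M (\<lambda>j. V ((x(i := t)) j)) (V s))"
    by (rule eq_matI) (use assms in \<open>auto simp: bordered_def\<close>)
  then show ?thesis
    using det_swaprows[of i "Suc M" M "bordered M (\<lambda>j. V ((x(i := t)) j)) (V s)"] assms by simp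
qed

lemma det_Vandermonde_nonzero:
  fixes t :: "nat \<Rightarrow> real"
  assumes inj: "inj_on t {..M}"
  shows "Determinant.det (Matrix.mat (Suc M) (Suc M) (\<lambda>(i, k). t i ^ k)) \<noteq> 0"
proof
  let ?A = "Matrix.mat (Suc M) (Suc M) (\<lambda>(i, k). t i ^ k)"
  assume "Determinant.det ?A = 0"
  then obtain v where v: "v \<in> carrier_vec (Suc M)" "v \<noteq> 0\<^sub>v (Suc M)" "?A *\<^sub>v v = 0\<^sub>v (Suc M)"
    using det_0_iff_vec_prod_zero[of ?A "Suc M"] by auto
  define p where "p = (\<Sum>k\<le>M. Polynomial.monom (vec_index v k) k)"
  have root: "poly p (t i) = 0" if "i \<le> M" for i
  proof -
    have "vec_index (?A *\<^sub>v v) i = (\<Sum>k<Suc M. t i ^ k * vec_index v k)"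
      using that v(1) by (simp add: scalar_prod_def atLeast0LessThan)
    then show ?thesis
      using v(3) that by (simp add: p_def poly_sum poly_monom lessThan_Suc_atMost mult.commute)
  qed
  have "p = 0"
  proof (rule ccontr)
    assume "p \<noteq> 0"
    have "Suc M = card (t ` {..M})"
      by (simp add: card_image[OF inj])
    also have "\<dots> \<le> card {x. poly p x = 0}"
      by (rule card_mono) (use \<open>p \<noteq> 0\<close> root in \<open>auto simp: poly_roots_finite\<close>)
    also have "\<dots> \<le> Polynomial.degree p"
      using \<open>p \<noteq> 0\<close> by (rule card_poly_roots_bound)
    also have "\<dots> \<le> M"
      unfolding p_def by (intro degree_sum_le) (auto intro: order_trans[OF degree_monom_le])
    finally show False by simp
  qed
  have "vec_index v k = 0" if "k \<le> M" for k
  proof -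
    have "poly.coeff p k = vec_index v k"
      using that by (simp add: p_def coeff_sum if_distrib cong: if_cong)
    then show ?thesis using \<open>p = 0\<close> by simp
  qed
  then have "v = 0\<^sub>v (Suc M)"
    using v(1) by (intro eq_vecI) auto
  with v(2) show False by simp
qed

section \<open>Polynomial functions of bounded degree\<close>

text \<open>The degree bound is an integer, and a negative bound forces the function to vanish.  Thus
  dividing out factors until the bound is negative shows that a function is zero.\<close>

inductive pol :: "('b \<Rightarrow> real) set \<Rightarrow> int \<Rightarrow> ('b \<Rightarrow> real) \<Rightarrow> bool" for X where
  zero: "pol X k (\<lambda>_. 0)"
| const: "0 \<le> k \<Longrightarrow> pol X k (\<lambda>_. c)"
| gen: "x \<in> X \<Longrightarrow> 1 \<le> k \<Longrightarrow> pol X k x"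
| add: "pol X k f \<Longrightarrow> pol X k g \<Longrightarrow> pol X k (\<lambda>p. f p + g p)"
| mult: "pol X k f \<Longrightarrow> pol X l g \<Longrightarrow> pol X (k + l) (\<lambda>p. f p * g p)"

lemma pol_neg: "pol X k f \<Longrightarrow> k < 0 \<Longrightarrow> f p = 0"
  by (induction arbitrary: p rule: pol.induct) (auto, metis add_nonneg_nonneg linorder_not_le)

lemma pol_mono: "pol X k f \<Longrightarrow> k \<le> l \<Longrightarrow> pol X l f"
proof (induction arbitrary: l rule: pol.induct)
  case (mult k f k' g)
  have "pol X (k + (l - k)) (\<lambda>p. f p * g p)"
    by (rule pol.mult[OF mult.hyps(1)]) (use mult in auto)
  then show ?case by simp
qed (auto intro: pol.intros)

lemma pol_mult_le: "pol X k f \<Longrightarrow> pol X l g \<Longrightarrow> k + l \<le> m \<Longrightarrow> pol X m (\<lambda>p. f p * g p)"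
  using pol.mult pol_mono by blast

lemma pol_uminus: "pol X k f \<Longrightarrow> pol X k (\<lambda>p. - f p)"
  using pol.mult[OF pol.const[of 0 X "-1"]] by fastforce

lemma pol_diff: "pol X k f \<Longrightarrow> pol X k g \<Longrightarrow> pol X k (\<lambda>p. f p - g p)"
  using pol.add[OF _ pol_uminus, of X k f g] by simp

lemma pol_power: "pol X k f \<Longrightarrow> pol X (int n * k) (\<lambda>p. f p ^ n)"
proof (induction n)
  case 0
  show ?case using pol.const[of 0 X 1] by simp
next
  case (Suc n)
  then show ?case using pol.mult[of X k f "int n * k" "\<lambda>p. f p ^ n"] by (simp add: algebra_simps)
qed

lemma pol_sum: "(\<And>i. i \<in> I \<Longrightarrow> pol X k (f i)) \<Longrightarrow> pol X k (\<lambda>p. \<Sum>i\<in>I. f i p)"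
  by (induction I rule: infinite_finite_induct) (auto intro: pol.intros)

lemma pol_subst: "pol X k f \<Longrightarrow> (\<And>x. x \<in> X \<Longrightarrow> pol Y 1 x) \<Longrightarrow> pol Y k f"
  by (induction rule: pol.induct) (auto intro: pol.intros pol_mono)

lemma pol_subset: "pol X k f \<Longrightarrow> X \<subseteq> Y \<Longrightarrow> pol Y k f"
  by (erule pol_subst) (auto intro: pol.gen)

lemma pol_cong_gens: "pol X k f \<Longrightarrow> (\<And>x. x \<in> X \<Longrightarrow> x p = x q) \<Longrightarrow> f p = f q"
  by (induction rule: pol.induct) auto

lemma pol_restrict_curve:
  fixes c :: "real \<Rightarrow> 'b"
  assumes "pol X k f" "Polynomial.degree W \<le> m"
    and "\<And>x. x \<in> X \<Longrightarrow> \<exists>g. Polynomial.degree g \<le> m \<and> (\<forall>t. poly g t = poly W t * x (c t))"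
  shows "\<exists>g. Polynomial.degree g \<le> m * nat k \<and> (\<forall>t. poly g t = poly W t ^ nat k * f (c t))"
  using assms(1)
proof (induction rule: pol.induct)
  case (zero k)
  show ?case by (intro exI[of _ 0]) auto
next
  case (const k a)
  have "Polynomial.degree (Polynomial.smult a (W ^ nat k)) \<le> m * nat k"
    using assms(2) by (meson degree_power_le degree_smult_le le_trans mult_le_mono1)
  then show ?case by (intro exI[of _ "Polynomial.smult a (W ^ nat k)"]) (auto simp: poly_power)
next
  case (gen x k)
  obtain g where g: "Polynomial.degree g \<le> m" "\<And>t. poly g t = poly W t * x (c t)"
    using assms(3) gen by blast
  have k: "nat k = Suc (nat (k - 1))" using gen by simp
  have "Polynomial.degree (W ^ nat (k - 1) * g) \<le> m * nat (k - 1) + m"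
    using assms(2) g(1) by (meson add_mono degree_mult_le degree_power_le le_trans mult_le_mono1)
  then show ?case
    by (intro exI[of _ "W ^ nat (k - 1) * g"]) (auto simp: k g(2) poly_power)
next
  case (add k f g)
  then obtain f' g' where "Polynomial.degree f' \<le> m * nat k" "\<And>t. poly f' t = poly W t ^ nat k * f (c t)"
    "Polynomial.degree g' \<le> m * nat k" "\<And>t. poly g' t = poly W t ^ nat k * g (c t)" by blast
  then show ?case
    by (intro exI[of _ "f' + g'"]) (auto simp: distrib_left degree_add_le)
next
  case (mult k f l g)
  show ?case
  proof (cases "k < 0 \<or> l < 0")
    case True
    then have "f p * g p = 0" for p
      using pol_neg mult.hyps by (metis mult_eq_0_iff)
    then show ?thesis by (intro exI[of _ 0]) auto
  next
    case False
    from mult obtain f' g' where f': "Polynomial.degree f' \<le> m * nat k" "\<And>t. poly f' t = poly W t ^ nat k * f (c t)"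
      and g': "Polynomial.degree g' \<le> m * nat l" "\<And>t. poly g' t = poly W t ^ nat l * g (c t)" by blast
    have "Polynomial.degree (f' * g') \<le> m * nat k + m * nat l"
      using f'(1) g'(1) by (meson add_mono degree_mult_le le_trans)
    then show ?thesis using False
      by (intro exI[of _ "f' * g'"]) (auto simp: f'(2) g'(2) nat_add_distrib power_add algebra_simps)
  qed
qed

definition affine_funs :: "(real^3 \<Rightarrow> real) set" where
  "affine_funs = range (\<lambda>(a, c) x. inner x a + c)"

lemma affI: "(\<lambda>x. inner x a + c) \<in> affine_funs"
  unfolding affine_funs_def by (rule image_eqI[of _ _ "(a, c)"]) auto

lemma affE: assumes "x \<in> affine_funs" obtains a c where "x = (\<lambda>p. inner p a + c)"
  using assms by (auto simp: affine_funs_def)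

lemma aff_inner_diff: "(\<lambda>w. inner (w - p) a) \<in> affine_funs"
  using affI[of a "- inner p a"] by (simp add: inner_diff_left)

lemma pol_continuous: "pol affine_funs k f \<Longrightarrow> continuous_on A f"
  by (induction rule: pol.induct) (auto elim!: affE intro!: continuous_intros)

lemma pol_restrict_line:
  assumes "pol affine_funs k f"
  obtains g where "\<And>t. poly g t = f (a + t *\<^sub>R b)"
proof -
  have "\<exists>g. Polynomial.degree g \<le> 1 * nat k \<and> (\<forall>t. poly g t = poly 1 t ^ nat k * f (a + t *\<^sub>R b))"
  proof (rule pol_restrict_curve[OF assms])
    fix x :: "real^3 \<Rightarrow> real" assume "x \<in> affine_funs"
    then obtain v d where x: "x = (\<lambda>p. inner p v + d)" by (rule affE)
    have "Polynomial.degree [:inner a v + d, inner b v:] \<le> 1" by simp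
    then show "\<exists>g. Polynomial.degree g \<le> 1 \<and> (\<forall>t. poly g t = poly 1 t * x (a + t *\<^sub>R b))"
      by (intro exI[of _ "[:inner a v + d, inner b v:]"]) (auto simp: x inner_add_left)
  qed auto
  then show thesis using that by auto
qed

lemma poly_infinite_zeros: "infinite {t. poly g t = 0} \<Longrightarrow> g = 0" for g :: "real poly"
  using poly_roots_finite by blast

lemma pol_line_zero:
  assumes "pol affine_funs k f" "infinite {t. f (a + t *\<^sub>R b) = 0}"
  shows "f (a + t *\<^sub>R b) = 0"
proof -
  obtain g where g: "\<And>t. poly g t = f (a + t *\<^sub>R b)" by (rule pol_restrict_line[OF assms(1)]) blast
  then have "g = 0" using assms(2) by (intro poly_infinite_zeros) simp
  then show ?thesis using g[of t] by simp
qed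

lemma pol_mult_eq_0:
  assumes "pol affine_funs k f" "pol affine_funs l g" "f x \<noteq> 0" "g y \<noteq> 0"
  obtains z where "f z * g z \<noteq> 0"
proof -
  obtain F where F: "\<And>t. poly F t = f (x + t *\<^sub>R (y - x))" by (rule pol_restrict_line[OF assms(1)]) blast
  obtain G where G: "\<And>t. poly G t = g (x + t *\<^sub>R (y - x))" by (rule pol_restrict_line[OF assms(2)]) blast
  have "F \<noteq> 0" "G \<noteq> 0" using F[of 0] G[of 1] assms(3,4) by auto
  then have "F * G \<noteq> 0" by simp
  then obtain t where "poly (F * G) t \<noteq> 0" by (metis poly_all_0_iff_0)
  then show thesis using that[of "x + t *\<^sub>R (y - x)"] by (simp add: F G)
qed

lemma pol_div_linear:
  assumes "pol (insert z Y) k F"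
  shows "\<exists>G F0. pol (insert z Y) (k - 1) G \<and> pol Y k F0 \<and> F = (\<lambda>p. (z p - h) * G p + F0 p)"
  using assms
proof (induction rule: pol.induct)
  case (zero k)
  show ?case by (intro exI[of _ "\<lambda>_. 0"]) (auto intro: pol.zero)
next
  case (const k c)
  then show ?case by (intro exI[of _ "\<lambda>_. 0"] exI[of _ "\<lambda>_. c"]) (auto intro: pol.zero pol.const)
next
  case (gen x k)
  show ?case
  proof (cases "x \<in> Y")
    case True
    then show ?thesis using gen by (intro exI[of _ "\<lambda>_. 0"] exI[of _ "x"]) (auto intro: pol.zero pol.gen)
  next
    case False
    then show ?thesis using gen
      by (intro exI[of _ "\<lambda>_. 1"] exI[of _ "\<lambda>_. h"]) (auto intro: pol.const)
  qed
next
  case (add k f g)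
  then obtain G F0 G' F0' where *: "pol (insert z Y) (k - 1) G" "pol Y k F0" "f = (\<lambda>p. (z p - h) * G p + F0 p)"
     "pol (insert z Y) (k - 1) G'" "pol Y k F0'" "g = (\<lambda>p. (z p - h) * G' p + F0' p)" by blast
  then show ?case
    by (intro exI[of _ "\<lambda>p. G p + G' p"] exI[of _ "\<lambda>p. F0 p + F0' p"]) (auto intro: pol.add simp: algebra_simps)
next
  case (mult k f l g)
  then obtain G F0 G' F0' where *: "pol (insert z Y) (k - 1) G" "pol Y k F0" "f = (\<lambda>p. (z p - h) * G p + F0 p)"
     "pol (insert z Y) (l - 1) G'" "pol Y l F0'" "g = (\<lambda>p. (z p - h) * G' p + F0' p)" by blast
  have "pol (insert z Y) k F0" using *(2) by (rule pol_subset) auto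
  then have "pol (insert z Y) (k + l - 1) (\<lambda>p. G p * g p + F0 p * G' p)"
    using * mult.hyps by (intro pol.add pol_mult_le[OF *(1) mult.hyps(2)] pol_mult_le[OF _ *(4)]) auto
  moreover have "pol Y (k + l) (\<lambda>p. F0 p * F0' p)" using * by (intro pol.mult)
  ultimately show ?case
    by (intro exI[of _ "\<lambda>p. G p * g p + F0 p * G' p"] exI[of _ "\<lambda>p. F0 p * F0' p"])
       (auto simp: *(3,6) algebra_simps)
qed

lemma pol_div_quadratic:
  assumes "pol (insert x Y) k F" and q: "pol Y 2 q"
  shows "\<exists>H A B. pol (insert x Y) (k - 2) H \<and> pol Y (k - 1) A \<and> pol Y k B \<and>
    F = (\<lambda>p. ((x p)\<^sup>2 + q p) * H p + x p * A p + B p)"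
  using assms(1)
proof (induction rule: pol.induct)
  case (zero k)
  show ?case by (intro exI[of _ "\<lambda>_. 0"]) (auto intro: pol.zero)
next
  case (const k c)
  then show ?case by (intro exI[of _ "\<lambda>_. 0"] exI[of _ "\<lambda>_. c"]) (auto intro: pol.zero pol.const)
next
  case (gen u k)
  show ?case
  proof (cases "u \<in> Y")
    case True
    then show ?thesis using gen by (intro exI[of _ "\<lambda>_. 0"] exI[of _ "u"]) (auto intro: pol.zero pol.gen)
  next
    case False
    then show ?thesis using gen
      by (intro exI[of _ "\<lambda>_. 0"] exI[of _ "\<lambda>_. 1"] exI[of _ "\<lambda>_. 0"]) (auto intro: pol.const pol.zero)
  qed
next
  case (add k f g)
  then obtain H A B H' A' B' where *: "pol (insert x Y) (k - 2) H" "pol Y (k - 1) A" "pol Y k B"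
     "f = (\<lambda>p. ((x p)\<^sup>2 + q p) * H p + x p * A p + B p)"
     "pol (insert x Y) (k - 2) H'" "pol Y (k - 1) A'" "pol Y k B'"
     "g = (\<lambda>p. ((x p)\<^sup>2 + q p) * H' p + x p * A' p + B' p)" by blast
  then show ?case
    by (intro exI[of _ "\<lambda>p. H p + H' p"] exI[of _ "\<lambda>p. A p + A' p"] exI[of _ "\<lambda>p. B p + B' p"])
       (auto intro: pol.add simp: algebra_simps)
next
  case (mult k f l g)
  then obtain H A B H' A' B' where *: "pol (insert x Y) (k - 2) H" "pol Y (k - 1) A" "pol Y k B"
     "f = (\<lambda>p. ((x p)\<^sup>2 + q p) * H p + x p * A p + B p)"
     "pol (insert x Y) (l - 2) H'" "pol Y (l - 1) A'" "pol Y l B'"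
     "g = (\<lambda>p. ((x p)\<^sup>2 + q p) * H' p + x p * A' p + B' p)" by blast
  have up: "pol (insert x Y) j u" if "pol Y j u" for j u
    using that by (rule pol_subset) auto
  have x: "pol (insert x Y) 1 x" by (rule pol.gen) auto
  have r: "pol (insert x Y) k (\<lambda>p. x p * A p + B p)"
    by (intro pol.add pol_mult_le[OF x up[OF *(2)]] up *) auto
  have "pol (insert x Y) (k + l - 2) (\<lambda>p. H p * g p + (x p * A p + B p) * H' p + A p * A' p)"
    by (intro pol.add pol_mult_le[OF *(1) mult.hyps(2)] pol_mult_le[OF r *(5)]
        pol_mult_le[OF up[OF *(2)] up[OF *(6)]]) auto
  moreover have "pol Y (k + l - 1) (\<lambda>p. A p * B' p + B p * A' p)"
    by (intro pol.add pol_mult_le[OF *(2) *(7)] pol_mult_le[OF *(3) *(6)]) auto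
  moreover have "pol Y (k + l) (\<lambda>p. B p * B' p - q p * (A p * A' p))"
    by (intro pol_diff pol_mult_le[OF *(3) *(7)] pol_mult_le[OF q pol.mult[OF *(2) *(6)]]) auto
  ultimately show ?case
    by (intro exI[of _ "\<lambda>p. H p * g p + (x p * A p + B p) * H' p + A p * A' p"]
        exI[of _ "\<lambda>p. A p * B' p + B p * A' p"] exI[of _ "\<lambda>p. B p * B' p - q p * (A p * A' p)"] conjI)
       (auto simp: *(4,8) algebra_simps power2_eq_square)
qed

section \<open>A weak polynomial ham sandwich theorem\<close>

text \<open>The exponents are the digits of \<open>k\<close> in base \<open>b\<close>, so that the monomials become the
  distinct powers \<open>s ^ k\<close> on the curve \<open>(s, s ^ b, s ^ (b * b))\<close>.\<close>

definition monomial3 :: "nat \<Rightarrow> nat \<Rightarrow> real^3 \<Rightarrow> real" where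
  "monomial3 b k p = inner p (axis 1 1) ^ (k mod b) * inner p (axis 2 1) ^ (k div b mod b)
     * inner p (axis 3 1) ^ (k div (b * b))"

lemma pol_monomial3:
  assumes "k < Suc d ^ 3"
  shows "pol affine_funs (3 * int d) (monomial3 (Suc d) k)"
proof -
  have coord: "pol affine_funs (int j) (\<lambda>p. inner p a ^ j)" for j a
    using pol_power[OF pol.gen[OF affI[of a 0]], of 1 j] by simp
  have "k div (Suc d * Suc d) < Suc d"
    using assms by (intro less_mult_imp_div_less) (simp add: power3_eq_cube algebra_simps)
  moreover have "k mod Suc d \<le> d" "k div Suc d mod Suc d \<le> d"
    by (simp_all add: less_Suc_eq_le[symmetric])
  ultimately have "int (k mod Suc d) + int (k div Suc d mod Suc d) + int (k div (Suc d * Suc d)) \<le> 3 * int d"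
    by linarith
  then show ?thesis
    unfolding monomial3_def by (intro pol_mult_le[OF pol.mult[OF coord coord] coord])
qed

lemma monomial3_moment_curve:
  assumes "p = (\<chi> i. if i = 1 then s else if i = 2 then s ^ b else s ^ (b * b))"
  shows "monomial3 b k p = s ^ k"
proof -
  have "monomial3 b k p = s ^ (k mod b) * (s ^ b) ^ (k div b mod b) * (s ^ (b * b)) ^ (k div (b * b))"
    by (simp add: monomial3_def inner_axis assms)
  also have "\<dots> = s ^ (k mod b + b * (k div b mod b) + b * b * (k div (b * b)))"
    by (simp add: power_add power_mult)
  also have "k mod b + b * (k div b mod b) + b * b * (k div (b * b)) = k"
    by (simp add: div_mult2_eq mult.assoc add.assoc flip: distrib_left)
  finally show ?thesis .
qed

lemma exists_sparse_bad_choice: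
  fixes w :: "nat \<Rightarrow> real"
  assumes fin: "finite X" and ne: "X \<noteq> {}" and w: "\<And>i. i < M \<Longrightarrow> 0 \<le> w i"
    and half: "\<And>i. i < M \<Longrightarrow> 2 * card {x \<in> X. B x i} \<le> card X"
  shows "\<exists>x\<in>X. 2 * (\<Sum>i | i < M \<and> B x i. w i) \<le> (\<Sum>i<M. w i)"
proof (rule ccontr)
  assume *: "\<not> ?thesis"
  have "(\<Sum>x\<in>X. \<Sum>i<M. w i) < (\<Sum>x\<in>X. 2 * (\<Sum>i | i < M \<and> B x i. w i))"
    by (rule sum_strict_mono) (use * fin ne in \<open>auto simp: not_le\<close>)
  also have "\<dots> = (\<Sum>x\<in>X. \<Sum>i<M. if B x i then 2 * w i else 0)"
    by (simp add: sum.If_cases sum_distrib_left Int_def)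
  also have "\<dots> = (\<Sum>i<M. \<Sum>x\<in>X. if B x i then 2 * w i else 0)"
    by (rule sum.swap)
  also have "\<dots> = (\<Sum>i<M. w i * real (2 * card {x \<in> X. B x i}))"
    using fin by (simp add: sum.If_cases Int_def mult_ac)
  also have "\<dots> \<le> (\<Sum>i<M. w i * real (card X))"
    by (intro sum_mono mult_left_mono) (use half w in \<open>auto simp del: of_nat_mult\<close>)
  also have "\<dots> = (\<Sum>x\<in>X. \<Sum>i<M. w i)"
    by (simp add: sum_distrib_right[symmetric] mult.commute)
  finally show False by simp
qed

lemma weak_ham_sandwich_nat:
  fixes S :: "nat \<Rightarrow> (real^3) set" and w :: "nat \<Rightarrow> real"
  assumes fin: "\<And>i. i < M \<Longrightarrow> finite (S i)" and ne: "\<And>i. i < M \<Longrightarrow> S i \<noteq> {}"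
    and disj: "\<And>i j. i < M \<Longrightarrow> j < M \<Longrightarrow> i \<noteq> j \<Longrightarrow> S i \<inter> S j = {}"
    and w: "\<And>i. i < M \<Longrightarrow> 0 \<le> w i" and d: "M < Suc d ^ 3"
  obtains l where "pol affine_funs (3 * int d) l" "\<exists>y. l y \<noteq> 0"
    "2 * (\<Sum>i | i < M \<and> (7 * card (S i) < 8 * card {y \<in> S i. 0 < l y} \<or>
        7 * card (S i) < 8 * card {y \<in> S i. l y < 0}). w i) \<le> (\<Sum>i<M. w i)"
proof -
  define X where "X = (\<Union>i<M. S i)"
  have "finite X" using fin by (auto simp: X_def)
  then obtain h :: "real^3 \<Rightarrow> nat" and n where h: "h ` X = {i. i < n}" "inj_on h X"
    by (metis finite_imp_inj_to_nat_seg)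
  txt \<open>The zero set of \<open>D x\<close> passes through the chosen points \<open>x i \<in> S i\<close>, and exchanging \<open>x i\<close>
    with the argument changes the sign of \<open>D x\<close>: this is a tournament on \<open>S i\<close>.  The choice may be degenerate for the
    monomials, so they are perturbed by Vandermonde rows, the perturbation being infinitely small
    because polynomials are ordered by their behaviour at infinity.\<close>
  define V where "V = (\<lambda>y k. [:real (h y) ^ k, monomial3 (Suc d) k y:])"
  define D where "D = (\<lambda>x y. Determinant.det (bordered M (\<lambda>j. V (x j)) (V y)))"
  let ?bad = "\<lambda>x i. 7 * card (S i) < 8 * card {y \<in> S i. 0 < D x y} \<or>
        7 * card (S i) < 8 * card {y \<in> S i. D x y < 0}"
  have "\<exists>x\<in>PiE {..<M} S. 2 * (\<Sum>i | i < M \<and> ?bad x i. w i) \<le> (\<Sum>i<M. w i)"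
  proof (rule exists_sparse_bad_choice)
    show "finite (PiE {..<M} S)" using fin by (intro finite_PiE) auto
    show "PiE {..<M} S \<noteq> {}" using ne by (auto simp: PiE_eq_empty_iff)
    fix i assume i: "i < M"
    show "2 * card {x \<in> PiE {..<M} S. ?bad x i} \<le> card (PiE {..<M} S)"
    proof (rule PiE_card_slicewise[where i = i])
      fix g assume "g \<in> PiE ({..<M} - {i}) S"
      show "2 * card {s \<in> S i. ?bad (g(i := s)) i} \<le> card (S i)"
        using tournament_half_balanced[OF fin[OF i], of "\<lambda>s y. D (g(i := s)) y"]
          det_bordered_swap[OF i, of V g] unfolding D_def by blast
    qed (use fin i in auto)
  qed (use w in auto)
  then obtain x where x: "x \<in> PiE {..<M} S" and good: "2 * (\<Sum>i | i < M \<and> ?bad x i. w i) \<le> (\<Sum>i<M. w i)"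
    by blast
  obtain c where c: "\<And>z. Determinant.det (bordered M (\<lambda>j. V (x j)) z) = (\<Sum>k\<le>M. z k * c k)"
    by (rule det_bordered_linear[of M "\<lambda>j. V (x j)"]) blast
  have c_nonzero: "\<exists>k\<le>M. c k \<noteq> 0"
  proof (rule ccontr)
    assume *: "\<not> ?thesis"
    define t where "t = (\<lambda>i. if i < M then real (h (x i)) else real n)"
    let ?B = "bordered M (\<lambda>j. V (x j)) (\<lambda>k. [:real n ^ k:])"
    have xX: "x i \<in> X" if "i < M" for i using x that by (auto simp: X_def)
    have "h (x i) \<noteq> h (x j)" if "i < M" "j < M" "i \<noteq> j" for i j
    proof -
      have "x i \<in> S i" "x j \<in> S j" using x that by auto
      then have "x i \<noteq> x j" using disj[OF that] by auto
      then show ?thesis using h(2) xX that by (auto dest: inj_onD)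
    qed
    moreover have "h (x i) \<noteq> n" if "i < M" for i using h(1) xX[OF that] by auto
    ultimately have "t i \<noteq> t j" if "i \<le> M" "j \<le> M" "i \<noteq> j" for i j
      using that by (cases "i < M"; cases "j < M") (auto simp: t_def eq_commute[of n])
    then have "inj_on t {..M}" unfolding inj_on_def by blast
    then have "Determinant.det (Matrix.mat (Suc M) (Suc M) (\<lambda>(i, k). t i ^ k)) \<noteq> 0"
      by (rule det_Vandermonde_nonzero)
    moreover have "Matrix.mat (Suc M) (Suc M) (\<lambda>(i, k). t i ^ k) = map_mat (\<lambda>p. poly p 0) ?B"
      by (rule eq_matI) (auto simp: bordered_def t_def V_def)
    moreover interpret comm_ring_hom "\<lambda>p. poly p (0::real)" by unfold_locales auto
    have "Determinant.det (map_mat (\<lambda>p. poly p 0) ?B) = poly (Determinant.det ?B) 0"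
      by (rule hom_det)
    moreover have "Determinant.det ?B = 0" using c * by simp
    ultimately show False by simp
  qed
  define m where "m = Max (Polynomial.degree ` c ` {..M})"
  have deg: "Polynomial.degree (c k) \<le> m" if "k \<le> M" for k
    unfolding m_def using that by (intro Max_ge) auto
  define a where "a = (\<lambda>k. poly.coeff (c k) m)"
  have a_nonzero: "\<exists>k\<le>M. a k \<noteq> 0"
  proof (cases "m = 0")
    case True
    obtain k where k: "k \<le> M" "c k \<noteq> 0" using c_nonzero by blast
    with deg[of k] True have "Polynomial.degree (c k) = m" by simp
    with k show ?thesis unfolding a_def by (metis leading_coeff_0_iff)
  next
    case False
    have "m \<in> Polynomial.degree ` c ` {..M}" unfolding m_def by (rule Max_in) auto
    then obtain k where "k \<le> M" "Polynomial.degree (c k) = m" by auto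
    with False show ?thesis unfolding a_def
      by (intro exI[of _ k]) (metis degree_0 leading_coeff_0_iff)
  qed
  define l where "l = (\<lambda>y. \<Sum>k\<le>M. a k * monomial3 (Suc d) k y)"
  have coeffD: "poly.coeff (D x y) (Suc m) = l y" for y
  proof -
    have "poly.coeff (V y k * c k) (Suc m) = a k * monomial3 (Suc d) k y" if "k \<le> M" for k
      using deg[OF that] by (simp add: V_def a_def coeff_eq_0 mult.commute)
    then show ?thesis by (simp add: D_def c l_def coeff_sum)
  qed
  have degD: "Polynomial.degree (D x y) \<le> Suc m" for y
    unfolding D_def c
  proof (intro degree_sum_le)
    fix k assume "k \<in> {..M}"
    have "Polynomial.degree (V y k * c k) \<le> Polynomial.degree (V y k) + Polynomial.degree (c k)"
      by (rule degree_mult_le)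
    also have "\<dots> \<le> 1 + m"
      using deg[of k] \<open>k \<in> {..M}\<close> by (intro add_mono) (auto simp: V_def)
    finally show "Polynomial.degree (V y k * c k) \<le> Suc m" by simp
  qed auto
  have degD_eq: "Polynomial.degree (D x y) = Suc m" if "l y \<noteq> 0" for y
    using degD[of y] coeffD[of y] that by (metis le_antisym le_degree)
  have pos: "0 < D x y" if "0 < l y" for y
    unfolding less_poly_def pos_poly_def using that by (simp add: degD_eq coeffD)
  have neg: "D x y < 0" if "l y < 0" for y
    unfolding less_poly_def pos_poly_def using that by (simp add: degD_eq coeffD)
  show thesis
  proof
    show "pol affine_funs (3 * int d) l"
      unfolding l_def using d
      by (intro pol_sum pol_mult_le[OF pol.const[of 0] pol_monomial3[of _ d]]) auto
    show "\<exists>y. l y \<noteq> 0"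
    proof (rule ccontr)
      assume *: "\<not> ?thesis"
      have "(\<Sum>k\<le>M. a k * s ^ k) = 0" for s
      proof -
        let ?p = "(\<chi> i. if i = 1 then s else if i = 2 then s ^ Suc d else s ^ (Suc d * Suc d)) :: real^3"
        have "l ?p = (\<Sum>k\<le>M. a k * s ^ k)"
          unfolding l_def by (intro sum.cong refl) (simp only: monomial3_moment_curve[OF refl])
        then show ?thesis using * by metis
      qed
      with a_nonzero show False by (metis zero_polynom_imp_zero_coeffs)
    qed
    let ?bad' = "\<lambda>i. 7 * card (S i) < 8 * card {y \<in> S i. 0 < l y} \<or>
        7 * card (S i) < 8 * card {y \<in> S i. l y < 0}"
    have "?bad x i" if "i < M" "?bad' i" for i
    proof -
      have "card {y \<in> S i. 0 < l y} \<le> card {y \<in> S i. 0 < D x y}"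
        "card {y \<in> S i. l y < 0} \<le> card {y \<in> S i. D x y < 0}"
        using fin[OF that(1)] pos neg by (auto intro!: card_mono)
      then show ?thesis using that(2) by linarith
    qed
    then have "(\<Sum>i | i < M \<and> ?bad' i. w i) \<le> (\<Sum>i | i < M \<and> ?bad x i. w i)"
      by (intro sum_mono2) (use w in auto)
    then show "2 * (\<Sum>i | i < M \<and> ?bad' i. w i) \<le> (\<Sum>i<M. w i)"
      using good by linarith
  qed
qed

lemma weak_ham_sandwich:
  fixes \<A> :: "(real^3) set set" and w :: "(real^3) set \<Rightarrow> real"
  assumes fin: "finite \<A>" "\<And>S. S \<in> \<A> \<Longrightarrow> finite S" and ne: "{} \<notin> \<A>"
    and disj: "disjoint \<A>" and w: "\<And>S. S \<in> \<A> \<Longrightarrow> 0 \<le> w S" and d: "card \<A> < Suc d ^ 3"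
  obtains l where "pol affine_funs (3 * int d) l" "\<exists>y. l y \<noteq> 0"
    "2 * (\<Sum>S\<in>{S \<in> \<A>. 7 * card S < 8 * card {y \<in> S. 0 < l y} \<or>
        7 * card S < 8 * card {y \<in> S. l y < 0}}. w S) \<le> (\<Sum>S\<in>\<A>. w S)"
proof -
  obtain f where f: "bij_betw f {..<card \<A>} \<A>"
    using ex_bij_betw_nat_finite[OF fin(1)] by (auto simp: atLeast0LessThan)
  have mem: "f i \<in> \<A>" if "i < card \<A>" for i using f that by (auto simp: bij_betw_def)
  have inj: "inj_on f {..<card \<A>}" using f by (simp add: bij_betw_def)
  have disj': "f i \<inter> f j = {}" if "i < card \<A>" "j < card \<A>" "i \<noteq> j" for i j
  proof -
    have "f i \<noteq> f j" using inj_onD[OF inj, of i j] that by auto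
    then show ?thesis using disj mem that by (auto simp: disjoint_def)
  qed
  obtain l where l: "pol affine_funs (3 * int d) l" "\<exists>y. l y \<noteq> 0"
    "2 * (\<Sum>i | i < card \<A> \<and> (7 * card (f i) < 8 * card {y \<in> f i. 0 < l y} \<or>
        7 * card (f i) < 8 * card {y \<in> f i. l y < 0}). w (f i)) \<le> (\<Sum>i<card \<A>. w (f i))"
  proof (rule weak_ham_sandwich_nat[of "card \<A>" f "\<lambda>i. w (f i)" d])
    show "finite (f i)" if "i < card \<A>" for i by (rule fin(2)[OF mem[OF that]])
    show "f i \<noteq> {}" if "i < card \<A>" for i using ne mem[OF that] by metis
    show "f i \<inter> f j = {}" if "i < card \<A>" "j < card \<A>" "i \<noteq> j" for i j
      by (rule disj'[OF that])
    show "0 \<le> w (f i)" if "i < card \<A>" for i by (rule w[OF mem[OF that]])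
  qed (rule d)
  have all: "(\<Sum>i<card \<A>. w (f i)) = (\<Sum>S\<in>\<A>. w S)"
    by (rule sum.reindex_bij_betw[OF f])
  have part: "(\<Sum>i | i < card \<A> \<and> Q (f i). w (f i)) = (\<Sum>S | S \<in> \<A> \<and> Q S. w S)" for Q
  proof -
    have "{S \<in> \<A>. Q S} = f ` {i. i < card \<A> \<and> Q (f i)}"
    proof (intro equalityI subsetI)
      fix S assume "S \<in> {S \<in> \<A>. Q S}"
      moreover from this obtain i where "i < card \<A>" "S = f i"
        using bij_betw_imp_surj_on[OF f] by (metis (no_types, lifting) imageE lessThan_iff mem_Collect_eq)
      ultimately show "S \<in> f ` {i. i < card \<A> \<and> Q (f i)}" by simp
    qed (auto simp: mem)
    moreover have "inj_on f {i. i < card \<A> \<and> Q (f i)}"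
      by (rule inj_on_subset[OF inj]) auto
    ultimately show ?thesis by (simp add: sum.reindex)
  qed
  show thesis by (rule that[OF l(1,2)]) (unfold part[symmetric] all[symmetric], rule l(3))
qed

section \<open>Polynomial partitioning\<close>

lemma sum_squares_balanced:
  fixes a b s :: real
  assumes "0 \<le> a" "0 \<le> b" "a + b \<le> s" "8 * a \<le> 7 * s" "8 * b \<le> 7 * s"
  shows "a\<^sup>2 + b\<^sup>2 \<le> 50 / 64 * s\<^sup>2"
proof -
  have *: "x\<^sup>2 + y\<^sup>2 \<le> 50 / 64 * s\<^sup>2" if "0 \<le> y" "x + y \<le> s" "8 * x \<le> 7 * s" "s \<le> 8 * x" for x y
  proof -
    have "0 \<le> (7 * s - 8 * x) * (8 * x - s)" using that by (intro mult_nonneg_nonneg) auto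
    then have "x\<^sup>2 + (s - x)\<^sup>2 \<le> 50 / 64 * s\<^sup>2" by (simp add: algebra_simps power2_eq_square)
    moreover have "y\<^sup>2 \<le> (s - x)\<^sup>2" using that by (intro power_mono) auto
    ultimately show ?thesis by linarith
  qed
  consider "s \<le> 8 * a" | "s \<le> 8 * b" | "8 * a \<le> s" "8 * b \<le> s" by linarith
  then show ?thesis
  proof cases
    case 3
    then have "(8 * a)\<^sup>2 \<le> s\<^sup>2" "(8 * b)\<^sup>2 \<le> s\<^sup>2"
      using assms by (simp_all only: power_mono mult_nonneg_nonneg zero_le_numeral)
    then have "64 * a\<^sup>2 \<le> s\<^sup>2" "64 * b\<^sup>2 \<le> s\<^sup>2" by (simp_all add: power_mult_distrib)
    then show ?thesis using zero_le_power2[of s] by linarith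
  qed (use *[of b a] *[of a b] assms in auto)
qed

definition heavy :: "real \<Rightarrow> 'b set set \<Rightarrow> 'b set set" where
  "heavy \<tau> \<A> = {S \<in> \<A>. \<tau> < real (card S)}"

definition energy :: "real \<Rightarrow> 'b set set \<Rightarrow> nat" where
  "energy \<tau> \<A> = (\<Sum>S\<in>heavy \<tau> \<A>. (card S)\<^sup>2)"

lemma card_heavy_le:
  assumes "0 < \<tau>"
  shows "real (card (heavy \<tau> \<A>)) \<le> real (energy \<tau> \<A>) / \<tau>\<^sup>2"
proof -
  have "(\<Sum>S\<in>heavy \<tau> \<A>. \<tau>\<^sup>2) \<le> (\<Sum>S\<in>heavy \<tau> \<A>. (real (card S))\<^sup>2)"
    using assms by (intro sum_mono power_mono) (auto simp: heavy_def)
  then show ?thesis using assms by (simp add: energy_def field_simps)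
qed

lemma energy_split_le:
  fixes l :: "'b \<Rightarrow> real"
  assumes fin: "finite \<A>" "\<And>S. S \<in> \<A> \<Longrightarrow> finite S"
    and bad: "2 * (\<Sum>S\<in>{S \<in> \<A>. 7 * card S < 8 * card {y \<in> S. 0 < l y} \<or>
        7 * card S < 8 * card {y \<in> S. l y < 0}}. real ((card S)\<^sup>2)) \<le> (\<Sum>S\<in>\<A>. real ((card S)\<^sup>2))"
  shows "real (energy \<tau> ((\<lambda>S. {y \<in> S. 0 < l y}) ` \<A> \<union> (\<lambda>S. {y \<in> S. l y < 0}) ` \<A>))
    \<le> 57 / 64 * (\<Sum>S\<in>\<A>. real ((card S)\<^sup>2))"
proof -
  let ?p = "\<lambda>S. {y \<in> S. 0 < l y}" and ?m = "\<lambda>S. {y \<in> S. l y < 0}"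
  let ?q = "\<lambda>S. real ((card S)\<^sup>2)"
  let ?bad = "\<lambda>S. 7 * card S < 8 * card (?p S) \<or> 7 * card S < 8 * card (?m S)"
  have "real (energy \<tau> (?p ` \<A> \<union> ?m ` \<A>)) \<le> (\<Sum>S\<in>?p ` \<A> \<union> ?m ` \<A>. ?q S)"
    unfolding energy_def of_nat_sum using fin by (intro sum_mono2) (auto simp: heavy_def)
  also have "\<dots> \<le> (\<Sum>S\<in>?p ` \<A>. ?q S) + (\<Sum>S\<in>?m ` \<A>. ?q S)"
    using sum.union_inter[of "?p ` \<A>" "?m ` \<A>" ?q] fin
      sum_nonneg[of "?p ` \<A> \<inter> ?m ` \<A>" ?q] by auto
  also have "\<dots> \<le> (\<Sum>S\<in>\<A>. ?q (?p S)) + (\<Sum>S\<in>\<A>. ?q (?m S))"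
    using fin by (intro add_mono) (metis (no_types, lifting) comp_apply of_nat_0_le_iff sum.cong sum_image_le)+
  also have "\<dots> = (\<Sum>S\<in>\<A>. ?q (?p S) + ?q (?m S))"
    by (simp add: sum.distrib)
  also have "\<dots> \<le> (\<Sum>S\<in>\<A>. 50 / 64 * ?q S + (if ?bad S then 14 / 64 * ?q S else 0))"
  proof (rule sum_mono)
    fix S assume S: "S \<in> \<A>"
    have "card (?p S) + card (?m S) = card (?p S \<union> ?m S)"
      using fin(2)[OF S] by (intro card_Un_disjoint[symmetric]) auto
    also have "\<dots> \<le> card S" using fin(2)[OF S] by (intro card_mono) auto
    finally have le: "card (?p S) + card (?m S) \<le> card S" .
    show "?q (?p S) + ?q (?m S) \<le> 50 / 64 * ?q S + (if ?bad S then 14 / 64 * ?q S else 0)"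
    proof (cases "?bad S")
      case False
      then show ?thesis
        using sum_squares_balanced[of "real (card (?p S))" "real (card (?m S))" "real (card S)"] le by simp
    next
      case True
      have "(card (?p S))\<^sup>2 + (card (?m S))\<^sup>2 \<le> (card (?p S) + card (?m S))\<^sup>2"
        by (simp add: power2_sum)
      also have "\<dots> \<le> (card S)\<^sup>2" using le by (intro power_mono) auto
      finally have "?q (?p S) + ?q (?m S) \<le> ?q S" by (simp only: of_nat_add[symmetric] of_nat_le_iff)
      then show ?thesis using True by simp
    qed
  qed
  also have "\<dots> = 50 / 64 * (\<Sum>S\<in>\<A>. ?q S) + 14 / 64 * (\<Sum>S\<in>{S \<in> \<A>. ?bad S}. ?q S)"
    using fin(1) by (simp add: sum.distrib sum_distrib_left sum.If_cases Int_def)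
  also have "\<dots> \<le> 57 / 64 * (\<Sum>S\<in>\<A>. ?q S)"
    using bad by simp
  finally show ?thesis .
qed

lemma connected_constant_sign:
  assumes "pol affine_funs k l" "connected A" "\<And>y. y \<in> A \<Longrightarrow> l y \<noteq> 0"
  shows "(\<forall>y\<in>A. 0 < l y) \<or> (\<forall>y\<in>A. l y < 0)"
proof (rule ccontr)
  assume "\<not> ?thesis"
  then obtain x y where xy: "x \<in> A" "y \<in> A" "l x < 0" "0 < l y"
    using assms(3) by (metis linorder_neqE_linordered_idom)
  have "connected (l ` A)"
    using assms by (intro connected_continuous_image pol_continuous)
  then have "0 \<in> l ` A"
    using xy by (intro connectedD_interval[of "l ` A" "l x" "l y" 0]) auto
  then show False using assms(3) by auto
qed

lemma nat_cube_root: obtains d :: nat where "d ^ 3 \<le> M" "M < Suc d ^ 3"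
proof -
  have "\<exists>d. d ^ 3 \<le> M \<and> M < Suc d ^ 3"
  proof (induction M)
    case (Suc M)
    then obtain d where d: "d ^ 3 \<le> M" "M < Suc d ^ 3" by blast
    show ?case
    proof (cases "Suc M < Suc d ^ 3")
      case False
      then have "Suc M = Suc d ^ 3" using d by simp
      then show ?thesis by (intro exI[of _ "Suc d"]) (simp add: power_strict_mono del: power_Suc)
    next
      case True
      then show ?thesis using d by (intro exI[of _ d]) simp
    qed
  qed auto
  then show thesis using that by blast
qed

lemma root3_le: "0 \<le> b \<Longrightarrow> a \<le> b ^ 3 \<Longrightarrow> root 3 a \<le> b"
  by (metis real_root_le_mono real_root_power_cancel zero_less_numeral)

lemma partition_heavy:
  assumes "0 < \<tau>" "finite \<A>" "\<And>S. S \<in> \<A> \<Longrightarrow> finite S" "disjoint \<A>"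
  shows "\<exists>k F. 0 \<le> k \<and> real_of_int k \<le> 100 * root 3 (real (energy \<tau> \<A>) / \<tau>\<^sup>2) \<and> pol affine_funs k F \<and>
    (\<exists>y. F y \<noteq> 0) \<and>
    (\<forall>A S. connected A \<longrightarrow> (\<forall>y\<in>A. F y \<noteq> 0) \<longrightarrow> S \<in> \<A> \<longrightarrow> real (card (A \<inter> S)) \<le> \<tau>)"
  using assms(2-)
proof (induction "energy \<tau> \<A>" arbitrary: \<A> rule: less_induct)
  case less
  define B where "B = heavy \<tau> \<A>"
  have light: "real (card (A \<inter> S)) \<le> \<tau>" if "S \<in> \<A> - B" for A S
  proof -
    have "card (A \<inter> S) \<le> card S" using that less.prems by (intro card_mono) auto
    then show ?thesis using that by (auto simp: B_def heavy_def)
  qed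
  show ?case
  proof (cases "B = {}")
    case True
    then show ?thesis using light
      by (intro exI[of _ 0] exI[of _ "\<lambda>_. 1"]) (auto intro: pol.const)
  next
    case False
    define E where "E = (\<Sum>S\<in>B. real ((card S)\<^sup>2))"
    have E: "E = real (energy \<tau> \<A>)" by (simp add: E_def B_def energy_def)
    have finB: "finite B" "\<And>S. S \<in> B \<Longrightarrow> finite S" using less.prems by (auto simp: B_def heavy_def)
    have neB: "{} \<notin> B" using assms(1) by (auto simp: B_def heavy_def)
    have disjB: "disjoint B" using less.prems(3) by (auto simp: B_def heavy_def disjoint_def)
    have Epos: "0 < E"
      unfolding E_def
    proof (rule sum_pos[OF finB(1) False])
      fix S assume "S \<in> B"
      then have "0 < real (card S)" using assms(1) by (simp add: B_def heavy_def)
      then show "0 < real ((card S)\<^sup>2)" by simp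
    qed
    obtain d where d: "d ^ 3 \<le> card B" "card B < Suc d ^ 3" by (rule nat_cube_root)
    obtain l where l: "pol affine_funs (3 * int d) l" "\<exists>y. l y \<noteq> 0"
      "2 * (\<Sum>S\<in>{S \<in> B. 7 * card S < 8 * card {y \<in> S. 0 < l y} \<or>
        7 * card S < 8 * card {y \<in> S. l y < 0}}. real ((card S)\<^sup>2)) \<le> (\<Sum>S\<in>B. real ((card S)\<^sup>2))"
      by (rule weak_ham_sandwich[OF finB neB disjB _ d(2), of "\<lambda>S. real ((card S)\<^sup>2)"]) auto
    define \<A>' where "\<A>' = (\<lambda>S. {y \<in> S. 0 < l y}) ` B \<union> (\<lambda>S. {y \<in> S. l y < 0}) ` B"
    have E': "real (energy \<tau> \<A>') \<le> 57 / 64 * E"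
      unfolding \<A>'_def E_def by (rule energy_split_le[OF finB l(3)])
    then have lt: "energy \<tau> \<A>' < energy \<tau> \<A>"
      using Epos E by linarith
    have finA': "finite \<A>'" "\<And>S. S \<in> \<A>' \<Longrightarrow> finite S"
      using finB by (auto simp: \<A>'_def)
    have disjA': "disjoint \<A>'"
    proof -
      have "X = Y" if XY: "X \<in> \<A>'" "Y \<in> \<A>'" "y \<in> X" "y \<in> Y" for X Y y
      proof -
        from XY obtain S where S: "S \<in> B" "X = {y \<in> S. 0 < l y} \<or> X = {y \<in> S. l y < 0}"
          unfolding \<A>'_def by blast
        from XY obtain T where T: "T \<in> B" "Y = {y \<in> T. 0 < l y} \<or> Y = {y \<in> T. l y < 0}"
          unfolding \<A>'_def by blast
        have "y \<in> S" "y \<in> T" using S T XY by auto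
        then have "S = T" using disjB S(1) T(1) by (auto simp: disjoint_def)
        then show "X = Y" using S(2) T(2) XY(3,4) by fastforce
      qed
      then show ?thesis unfolding disjoint_def by blast
    qed
    obtain k F where F: "0 \<le> k" "real_of_int k \<le> 100 * root 3 (real (energy \<tau> \<A>') / \<tau>\<^sup>2)"
      "pol affine_funs k F" "\<exists>y. F y \<noteq> 0"
      "\<And>A S. connected A \<Longrightarrow> \<forall>y\<in>A. F y \<noteq> 0 \<Longrightarrow> S \<in> \<A>' \<Longrightarrow> real (card (A \<inter> S)) \<le> \<tau>"
      using less.hyps[OF lt finA' disjA'] by blast
    show ?thesis
    proof (intro exI[of _ "3 * int d + k"] exI[of _ "\<lambda>y. l y * F y"] conjI allI impI)
      show "0 \<le> 3 * int d + k" using F by simp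
      show "pol affine_funs (3 * int d + k) (\<lambda>y. l y * F y)" by (rule pol.mult[OF l(1) F(3)])
      show "\<exists>y. l y * F y \<noteq> 0" using pol_mult_eq_0[OF l(1) F(3)] l(2) F(4) by metis
      let ?r = "root 3 (E / \<tau>\<^sup>2)"
      have r0: "0 \<le> ?r" using Epos by simp
      have "real d \<le> ?r"
      proof -
        have "real d ^ 3 \<le> real (card B)" using d(1) by (metis of_nat_le_iff of_nat_power)
        also have "\<dots> \<le> E / \<tau>\<^sup>2" unfolding B_def E by (rule card_heavy_le[OF assms(1)])
        finally have "root 3 (real d ^ 3) \<le> ?r" by simp
        then show ?thesis by (simp add: real_root_power_cancel)
      qed
      moreover have "root 3 (real (energy \<tau> \<A>') / \<tau>\<^sup>2) \<le> 97 / 100 * ?r"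
      proof -
        have "real (energy \<tau> \<A>') / \<tau>\<^sup>2 \<le> 57 / 64 * (E / \<tau>\<^sup>2)"
          using E' assms(1) by (simp add: field_simps)
        then have "root 3 (real (energy \<tau> \<A>') / \<tau>\<^sup>2) \<le> root 3 (57 / 64) * ?r"
          by (metis real_root_le_mono real_root_mult zero_less_numeral)
        also have "\<dots> \<le> 97 / 100 * ?r"
          by (intro mult_right_mono root3_le r0) (auto simp: power3_eq_cube)
        finally show ?thesis .
      qed
      ultimately show "real_of_int (3 * int d + k) \<le> 100 * root 3 (real (energy \<tau> \<A>) / \<tau>\<^sup>2)"
        using F(2) unfolding E[symmetric] by simp
      fix A S assume A: "connected A" "\<forall>y\<in>A. l y * F y \<noteq> 0" "S \<in> \<A>"
      show "real (card (A \<inter> S)) \<le> \<tau>"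
      proof (cases "S \<in> B")
        case True
        from connected_constant_sign[OF l(1) A(1)] A(2)
        have "A \<inter> S = A \<inter> {y \<in> S. 0 < l y} \<or> A \<inter> S = A \<inter> {y \<in> S. l y < 0}" by auto
        moreover have "{y \<in> S. 0 < l y} \<in> \<A>'" "{y \<in> S. l y < 0} \<in> \<A>'"
          using True by (auto simp: \<A>'_def)
        ultimately obtain S' where "S' \<in> \<A>'" "A \<inter> S = A \<inter> S'" by blast
        moreover have "\<forall>y\<in>A. F y \<noteq> 0" using A(2) by auto
        ultimately show ?thesis using F(5)[OF A(1), of S'] by simp
      next
        case False
        then show ?thesis using light A(3) by blast
      qed
    qed
  qed
qed

lemma polynomial_partition:
  fixes P :: "(real^3) set"
  assumes fin: "finite P"
  shows "\<exists>k F. 0 \<le> k \<and> real_of_int k \<le> 640 * root 3 (2 ^ j) \<and> pol affine_funs k F \<and> (\<exists>y. F y \<noteq> 0) \<and>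
    (\<forall>A. connected A \<longrightarrow> (\<forall>y\<in>A. F y \<noteq> 0) \<longrightarrow> card (A \<inter> P) * 2 ^ j \<le> card P)"
proof (induction j)
  case 0
  show ?case
    by (intro exI[of _ 0] exI[of _ "\<lambda>_. 1"]) (auto intro: pol.const card_mono fin)
next
  case (Suc j)
  then obtain k F where F: "0 \<le> k" "real_of_int k \<le> 640 * root 3 (2 ^ j)" "pol affine_funs k F" "\<exists>y. F y \<noteq> 0"
    "\<And>A. connected A \<Longrightarrow> \<forall>y\<in>A. F y \<noteq> 0 \<Longrightarrow> card (A \<inter> P) * 2 ^ j \<le> card P" by blast
  show ?case
  proof (cases "P = {}")
    case True
    then show ?thesis by (intro exI[of _ 0] exI[of _ "\<lambda>_. 1"]) (auto intro: pol.const)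
  next
    case False
    define n where "n = real (card P)"
    have n: "0 < n" using False fin by (simp add: n_def card_gt_0_iff)
    define \<tau> where "\<tau> = n / 2 ^ Suc j"
    have \<tau>: "0 < \<tau>" using n by (simp add: \<tau>_def)
    define U where "U = {y. F y \<noteq> 0}"
    define \<A> where "\<A> = (\<lambda>x. connected_component_set U x \<inter> P) ` P"
    have finA: "finite \<A>" "\<And>S. S \<in> \<A> \<Longrightarrow> finite S" using fin by (auto simp: \<A>_def)
    have disj: "disjoint \<A>"
    proof -
      have "connected_component_set U x \<inter> P = connected_component_set U y \<inter> P"
        if "z \<in> connected_component_set U x" "z \<in> connected_component_set U y" for x y z
        using that by (metis connected_component_eq)
      then show ?thesis unfolding disjoint_def \<A>_def by blast
    qed
    have size: "real (card S) \<le> 2 * \<tau>" if S: "S \<in> \<A>" for S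
    proof -
      from S obtain x where x: "S = connected_component_set U x \<inter> P" by (auto simp: \<A>_def)
      have "card S * 2 ^ j \<le> card P"
        unfolding x by (rule F(5)) (auto simp: U_def dest: connected_component_in)
      then have "real (card S) * 2 ^ j \<le> n"
        unfolding n_def by (metis of_nat_le_iff of_nat_mult of_nat_numeral of_nat_power)
      then show ?thesis by (simp add: \<tau>_def field_simps)
    qed
    have "(\<Sum>S\<in>\<A>. card S) = card (\<Union>\<A>)"
      using finA disj by (intro card_Union_disjoint[symmetric]) (auto simp: pairwise_def disjoint_def disjnt_def)
    also have "\<dots> \<le> card P" by (rule card_mono[OF fin]) (auto simp: \<A>_def)
    finally have tot: "(\<Sum>S\<in>\<A>. real (card S)) \<le> n" by (simp add: n_def flip: of_nat_sum)
    have "real (energy \<tau> \<A>) \<le> (\<Sum>S\<in>\<A>. real (card S) * real (card S))"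
      unfolding energy_def of_nat_sum using finA
      by (simp add: power2_eq_square) (intro sum_mono2, auto simp: heavy_def)
    also have "\<dots> \<le> (\<Sum>S\<in>\<A>. 2 * \<tau> * real (card S))"
      by (intro sum_mono mult_right_mono size) auto
    also have "\<dots> \<le> 2 * \<tau> * n"
      using tot \<tau> by (simp flip: sum_distrib_left)
    finally have "real (energy \<tau> \<A>) / \<tau>\<^sup>2 \<le> 4 * 2 ^ j"
      using \<tau> n by (simp add: \<tau>_def field_simps power2_eq_square)
    then have "root 3 (real (energy \<tau> \<A>) / \<tau>\<^sup>2) \<le> root 3 4 * root 3 (2 ^ j)"
      by (metis real_root_le_mono real_root_mult zero_less_numeral)
    also have "\<dots> \<le> 16 / 10 * root 3 (2 ^ j)"
      by (intro mult_right_mono root3_le) (auto simp: power3_eq_cube)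
    finally have root: "root 3 (real (energy \<tau> \<A>) / \<tau>\<^sup>2) \<le> 16 / 10 * root 3 (2 ^ j)" .
    obtain k' F' where F': "0 \<le> k'" "real_of_int k' \<le> 100 * root 3 (real (energy \<tau> \<A>) / \<tau>\<^sup>2)"
      "pol affine_funs k' F'" "\<exists>y. F' y \<noteq> 0"
      "\<And>A S. connected A \<Longrightarrow> \<forall>y\<in>A. F' y \<noteq> 0 \<Longrightarrow> S \<in> \<A> \<Longrightarrow> real (card (A \<inter> S)) \<le> \<tau>"
      using partition_heavy[OF \<tau> finA disj] by blast
    show ?thesis
    proof (intro exI[of _ "k + k'"] exI[of _ "\<lambda>y. F y * F' y"] conjI allI impI)
      show "0 \<le> k + k'" using F F' by simp
      show "pol affine_funs (k + k') (\<lambda>y. F y * F' y)" by (rule pol.mult[OF F(3) F'(3)])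
      show "\<exists>y. F y * F' y \<noteq> 0" using pol_mult_eq_0[OF F(3) F'(3)] F(4) F'(4) by metis
      have "5 / 4 * root 3 (2 ^ j) \<le> root 3 2 * root 3 (2 ^ j)"
      proof (intro mult_right_mono)
        have "root 3 ((5 / 4) ^ 3) \<le> root 3 2" by (intro real_root_le_mono) (auto simp: power3_eq_cube)
        then show "5 / 4 \<le> root 3 2" by (simp add: real_root_power_cancel)
      qed auto
      also have "\<dots> = root 3 (2 ^ Suc j)" by (simp add: real_root_mult)
      finally show "real_of_int (k + k') \<le> 640 * root 3 (2 ^ Suc j)"
        using F(2) F'(2) root by simp
      fix A assume A: "connected A" "\<forall>y\<in>A. F y * F' y \<noteq> 0"
      show "card (A \<inter> P) * 2 ^ Suc j \<le> card P"
      proof (cases "A \<inter> P = {}")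
        case False
        then obtain x where x: "x \<in> A" "x \<in> P" by auto
        let ?S = "connected_component_set U x \<inter> P"
        have "A \<subseteq> connected_component_set U x"
          using A x by (intro connected_component_maximal) (auto simp: U_def)
        then have "A \<inter> P = A \<inter> ?S" by auto
        moreover have "?S \<in> \<A>" using x by (auto simp: \<A>_def)
        ultimately have "real (card (A \<inter> P)) \<le> \<tau>" using F'(5)[OF A(1), of ?S] A(2) by simp
        then have "real (card (A \<inter> P) * 2 ^ Suc j) \<le> real (card P)" by (simp add: \<tau>_def n_def field_simps)
        then show ?thesis by (simp only: of_nat_le_iff)
      qed simp
    qed
  qed
qed

section \<open>Polynomials on circles and spheres\<close>

hide_const (open) Matrix.orthogonal

definition orthonormal3 :: "real^3 \<Rightarrow> real^3 \<Rightarrow> real^3 \<Rightarrow> bool" where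
  "orthonormal3 u v e \<longleftrightarrow> inner u u = 1 \<and> inner v v = 1 \<and> inner e e = 1 \<and> inner u v = 0 \<and> inner u e = 0 \<and> inner v e = 0"

lemma orthonormal3_expand:
  assumes "orthonormal3 u v e"
  shows "x = inner x u *\<^sub>R u + inner x v *\<^sub>R v + inner x e *\<^sub>R e"
proof -
  note o = assms[unfolded orthonormal3_def]
  have ne: "u \<noteq> v" "u \<noteq> e" "v \<noteq> e" "u \<noteq> 0" "v \<noteq> 0" "e \<noteq> 0" using o by auto
  have "pairwise orthogonal {u, v, e}" using o by (auto simp: pairwise_def real_inner_class.orthogonal_def inner_commute)
  then have ind: "independent {u, v, e}"
    using ne by (intro pairwise_orthogonal_independent) auto
  have "card {u, v, e} = 3" using ne by simp
  then have "UNIV \<subseteq> span {u, v, e}"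
    using ind by (intro card_ge_dim_independent) auto
  define d where "d = x - (inner x u *\<^sub>R u + inner x v *\<^sub>R v + inner x e *\<^sub>R e)"
  have "orthogonal d b" if "b \<in> {u, v, e}" for b
    using that o by (auto simp: d_def real_inner_class.orthogonal_def inner_diff_left inner_add_left inner_commute[of v u]
        inner_commute[of e u] inner_commute[of e v])
  then have "orthogonal d d"
    using \<open>UNIV \<subseteq> _\<close> by (intro orthogonal_to_span[of d "{u, v, e}"]) auto
  then show ?thesis by (simp add: orthogonal_self d_def)
qed

lemma orthonormal3_inner_self:
  assumes "orthonormal3 u v e"
  shows "inner x x = (inner x u)\<^sup>2 + (inner x v)\<^sup>2 + (inner x e)\<^sup>2"
  by (subst (2) orthonormal3_expand[OF assms, of x]) (simp add: inner_add_right power2_eq_square)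

lemma orthonormal3_of_pair:
  assumes "inner u u = 1" "inner v v = 1" "inner u v = 0"
  shows "orthonormal3 u v (cross3 u v)"
proof -
  have "inner (cross3 u v) (cross3 u v) = 1"
    using assms norm_cross[of u v] by (simp add: power2_norm_eq_inner)
  then show ?thesis using assms by (simp add: orthonormal3_def dot_cross_self)
qed

lemma orthonormal3_rotate: "orthonormal3 u v e \<Longrightarrow> orthonormal3 v e u"
  by (auto simp: orthonormal3_def inner_commute)

lemma exists_orthonormal3_first:
  assumes "inner u u = 1"
  obtains v e where "orthonormal3 u v e"
proof -
  obtain y where y: "y \<noteq> 0" "orthogonal u y"
    using orthogonal_to_vector_exists[of u] by auto
  have "inner (y /\<^sub>R norm y) (y /\<^sub>R norm y) = 1"
    using y by (simp add: dot_square_norm power2_eq_square)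
  moreover have "inner u (y /\<^sub>R norm y) = 0" using y by (simp add: real_inner_class.orthogonal_def)
  ultimately show thesis using that orthonormal3_of_pair assms by blast
qed

lemma exists_orthonormal3_last:
  assumes "inner e e = 1"
  obtains u v where "orthonormal3 u v e"
  using exists_orthonormal3_first[OF assms] orthonormal3_rotate by metis

lemma exists_orthonormal3_plane:
  assumes "inner u u = 1"
  obtains v e where "orthonormal3 u v e" "w = inner w u *\<^sub>R u + inner w v *\<^sub>R v"
proof (cases "w = inner w u *\<^sub>R u")
  case True
  obtain v e where "orthonormal3 u v e" by (rule exists_orthonormal3_first[OF assms])
  moreover have "inner w v = 0" by (subst True) (use \<open>orthonormal3 u v e\<close> in \<open>simp add: orthonormal3_def\<close>)
  ultimately show ?thesis using that True by simp
next
  case False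
  define y where "y = w - inner w u *\<^sub>R u"
  have y: "y \<noteq> 0" "inner u y = 0"
    using False assms by (auto simp: y_def inner_diff_right inner_commute)
  define v where "v = y /\<^sub>R norm y"
  have "inner v v = 1" "inner u v = 0"
    using y by (simp_all add: v_def dot_square_norm power2_eq_square)
  then have f: "orthonormal3 u v (cross3 u v)" using assms by (intro orthonormal3_of_pair)
  have w: "w = inner w u *\<^sub>R u + norm y *\<^sub>R v" using y by (simp add: v_def y_def)
  have "inner w v = norm y" by (subst w) (use f in \<open>simp add: inner_add_left orthonormal3_def\<close>)
  then show ?thesis using that[OF f] w by simp
qed

definition circle3 :: "real^3 \<Rightarrow> real^3 \<Rightarrow> real^3 \<Rightarrow> real \<Rightarrow> (real^3) set" where
  "circle3 c u v R = {c + (R * a) *\<^sub>R u + (R * b) *\<^sub>R v | a b. a\<^sup>2 + b\<^sup>2 = 1}"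

definition circle_param :: "real^3 \<Rightarrow> real^3 \<Rightarrow> real^3 \<Rightarrow> real \<Rightarrow> real \<Rightarrow> real^3" where
  "circle_param c u v R t = c + (R * ((1 - t\<^sup>2) / (1 + t\<^sup>2))) *\<^sub>R u + (R * (2 * t / (1 + t\<^sup>2))) *\<^sub>R v"

lemma one_plus_square_pos: "0 < 1 + (t::real)\<^sup>2"
  by (rule add_pos_nonneg) auto

lemma circle3_eq: "circle3 c u v R = insert (c - R *\<^sub>R u) (range (circle_param c u v R))"
proof (intro equalityI subsetI)
  fix w assume "w \<in> circle3 c u v R"
  then obtain a b where w: "w = c + (R * a) *\<^sub>R u + (R * b) *\<^sub>R v" and ab: "a\<^sup>2 + b\<^sup>2 = 1"
    by (auto simp: circle3_def)
  show "w \<in> insert (c - R *\<^sub>R u) (range (circle_param c u v R))"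
  proof (cases "a = -1")
    case True
    then show ?thesis using ab w by simp
  next
    case False
    define t where "t = b / (1 + a)"
    have a1: "1 + a \<noteq> 0" using False by simp
    have b2: "b\<^sup>2 = (1 + a) * (1 - a)" using ab by (simp add: algebra_simps power2_eq_square)
    have t2: "t\<^sup>2 = (1 - a) / (1 + a)"
      using a1 unfolding t_def power_divide b2 by (simp add: power2_eq_square)
    have s: "1 + t\<^sup>2 = 2 / (1 + a)" using a1 unfolding t2 by (simp add: field_simps)
    have "(1 - t\<^sup>2) / (1 + t\<^sup>2) = a" unfolding s unfolding t2 using a1 by (simp add: field_simps)
    moreover have "2 * t / (1 + t\<^sup>2) = b" unfolding s using a1 by (simp add: t_def)
    ultimately have "w = circle_param c u v R t" by (simp add: w circle_param_def)
    then show ?thesis by simp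
  qed
next
  fix w assume "w \<in> insert (c - R *\<^sub>R u) (range (circle_param c u v R))"
  then consider "w = c - R *\<^sub>R u" | t where "w = circle_param c u v R t" by auto
  then show "w \<in> circle3 c u v R"
  proof cases
    case 1
    then show ?thesis unfolding circle3_def by (intro CollectI exI[of _ "-1"] exI[of _ 0]) simp
  next
    case 2
    have "((1 - t\<^sup>2) / (1 + t\<^sup>2))\<^sup>2 + (2 * t / (1 + t\<^sup>2))\<^sup>2 = ((1 - t\<^sup>2)\<^sup>2 + (2 * t)\<^sup>2) / (1 + t\<^sup>2)\<^sup>2"
      by (simp add: power_divide add_divide_distrib)
    also have "(1 - t\<^sup>2)\<^sup>2 + (2 * t)\<^sup>2 = (1 + t\<^sup>2)\<^sup>2" by (simp add: algebra_simps power2_eq_square)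
    finally have "((1 - t\<^sup>2) / (1 + t\<^sup>2))\<^sup>2 + (2 * t / (1 + t\<^sup>2))\<^sup>2 = 1"
      using one_plus_square_pos[of t] by simp
    then show ?thesis unfolding circle3_def 2 circle_param_def by blast
  qed
qed

lemma circle3_minus: "circle3 c (- u) v R = circle3 c u v R"
proof -
  have "circle3 c (- u) v R \<subseteq> circle3 c u v R" for u
  proof
    fix w assume "w \<in> circle3 c (- u) v R"
    then obtain a b where "w = c + (R * a) *\<^sub>R (- u) + (R * b) *\<^sub>R v" "a\<^sup>2 + b\<^sup>2 = 1"
      by (auto simp: circle3_def)
    then show "w \<in> circle3 c u v R"
      unfolding circle3_def by (intro CollectI exI[of _ "- a"] exI[of _ b]) simp
  qed
  from this[of u] this[of "- u"] show ?thesis by simp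
qed

lemma pol_restrict_circle:
  assumes "pol affine_funs k f"
  obtains g where "Polynomial.degree g \<le> 2 * nat k" "\<And>t. poly g t = (1 + t\<^sup>2) ^ nat k * f (circle_param c u v R t)"
proof -
  have "\<exists>g. Polynomial.degree g \<le> 2 * nat k \<and>
    (\<forall>t. poly g t = poly [:1, 0, 1:] t ^ nat k * f (circle_param c u v R t))"
  proof (rule pol_restrict_curve[OF assms])
    fix x :: "real^3 \<Rightarrow> real" assume "x \<in> affine_funs"
    then obtain a d where x: "x = (\<lambda>p. inner p a + d)" by (rule affE)
    define h where "h = inner c a + d"
    let ?g = "[:h + R * inner u a, 2 * R * inner v a, h - R * inner u a:]"
    have "poly ?g t = poly [:1, 0, 1:] t * x (circle_param c u v R t)" for t
    proof -
      define \<alpha> where "\<alpha> = (1 - t\<^sup>2) / (1 + t\<^sup>2)"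
      define \<beta> where "\<beta> = 2 * t / (1 + t\<^sup>2)"
      have ab: "(1 + t\<^sup>2) * \<alpha> = 1 - t\<^sup>2" "(1 + t\<^sup>2) * \<beta> = 2 * t"
        using one_plus_square_pos[of t] by (simp_all add: \<alpha>_def \<beta>_def)
      have "x (circle_param c u v R t) = h + R * \<alpha> * inner u a + R * \<beta> * inner v a"
        by (simp add: x circle_param_def inner_add_left h_def \<alpha>_def \<beta>_def)
      then have "poly [:1, 0, 1:] t * x (circle_param c u v R t)
          = (1 + t\<^sup>2) * h + R * ((1 + t\<^sup>2) * \<alpha>) * inner u a + R * ((1 + t\<^sup>2) * \<beta>) * inner v a"
        by (simp add: algebra_simps power2_eq_square)
      then show ?thesis unfolding ab by (simp add: algebra_simps power2_eq_square)
    qed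
    moreover have "Polynomial.degree ?g \<le> 2" by simp
    ultimately show "\<exists>g. Polynomial.degree g \<le> 2 \<and> (\<forall>t. poly g t = poly [:1, 0, 1:] t * x (circle_param c u v R t))"
      by blast
  qed simp
  then show thesis using that by (auto simp: power2_eq_square)
qed

lemma pol_circle_param_zero:
  assumes "pol affine_funs k f" "infinite {t. f (circle_param c u v R t) = 0}"
  shows "f (circle_param c u v R t) = 0"
proof -
  obtain g where g: "\<And>t. poly g t = (1 + t\<^sup>2) ^ nat k * f (circle_param c u v R t)"
    by (rule pol_restrict_circle[OF assms(1)]) blast
  have nz: "1 + t\<^sup>2 \<noteq> 0" for t :: real using one_plus_square_pos[of t] by simp
  have "{t. poly g t = 0} = {t. f (circle_param c u v R t) = 0}" using nz by (simp add: g)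
  then have "g = 0" using assms(2) by (intro poly_infinite_zeros) simp
  then show ?thesis using g[of t] nz[of t] by simp
qed

lemma pol_circle_zero:
  assumes f: "pol affine_funs k f" and inf: "infinite {w \<in> circle3 c u v R. f w = 0}" and w: "w \<in> circle3 c u v R"
  shows "f w = 0"
proof -
  have *: "f (circle_param c u v R t) = 0" if "infinite {w \<in> circle3 c u v R. f w = 0}" for u t
  proof (rule pol_circle_param_zero[OF f], rule notI)
    assume "finite {t. f (circle_param c u v R t) = 0}"
    then have "finite (insert (c - R *\<^sub>R u) (circle_param c u v R ` {t. f (circle_param c u v R t) = 0}))" by blast
    moreover have "{w \<in> circle3 c u v R. f w = 0} \<subseteq> \<dots>" unfolding circle3_eq by auto
    ultimately show False using that finite_subset by blast
  qed
  have "f (circle_param c u v R t) = 0" for t by (rule *[OF inf])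
  moreover have "f (c - R *\<^sub>R u) = 0"
    using *[of "- u" 0] inf by (simp add: circle3_minus circle_param_def)
  ultimately show ?thesis using w by (auto simp: circle3_eq)
qed

lemma infinite_circle3:
  assumes "orthonormal3 u v e" "0 < R"
  shows "infinite (circle3 c u v R)"
proof
  assume fin: "finite (circle3 c u v R)"
  have "inj_on (\<lambda>a. c + (R * a) *\<^sub>R u + (R * sqrt (1 - a\<^sup>2)) *\<^sub>R v) {-1..1}"
  proof (rule inj_onI)
    fix a b assume eq: "c + (R * a) *\<^sub>R u + (R * sqrt (1 - a\<^sup>2)) *\<^sub>R v = c + (R * b) *\<^sub>R u + (R * sqrt (1 - b\<^sup>2)) *\<^sub>R v"
    have "inner (c + (R * a) *\<^sub>R u + (R * sqrt (1 - a\<^sup>2)) *\<^sub>R v) u = inner c u + R * a" for a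
      using assms(1) by (simp add: inner_add_left orthonormal3_def inner_commute[of v u])
    from this[of a] this[of b] show "a = b" using assms(2) unfolding eq by simp
  qed
  moreover have "(\<lambda>a. c + (R * a) *\<^sub>R u + (R * sqrt (1 - a\<^sup>2)) *\<^sub>R v) ` {-1..1} \<subseteq> circle3 c u v R"
  proof
    fix w assume "w \<in> (\<lambda>a. c + (R * a) *\<^sub>R u + (R * sqrt (1 - a\<^sup>2)) *\<^sub>R v) ` {-1..1}"
    then obtain a where a: "-1 \<le> a" "a \<le> 1" "w = c + (R * a) *\<^sub>R u + (R * sqrt (1 - a\<^sup>2)) *\<^sub>R v" by auto
    then have "a\<^sup>2 \<le> 1" by (simp add: abs_square_le_1 abs_le_iff)
    then show "w \<in> circle3 c u v R" unfolding circle3_def a(3)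
      by (intro CollectI exI[of _ a] exI[of _ "sqrt (1 - a\<^sup>2)"]) simp
  qed
  ultimately have "finite {-1..1::real}" using fin by (meson finite_imageD finite_subset)
  then show False by (simp add: infinite_Icc)
qed

lemma pol_circle_mult_zero:
  assumes "orthonormal3 u v e" "0 < R" "pol affine_funs k f" "pol affine_funs l g"
    and zero: "\<And>w. w \<in> circle3 c u v R \<Longrightarrow> f w * g w = 0"
    and ne: "w0 \<in> circle3 c u v R" "f w0 \<noteq> 0" and w: "w \<in> circle3 c u v R"
  shows "g w = 0"
proof -
  let ?A = "{w \<in> circle3 c u v R. f w = 0}" and ?B = "{w \<in> circle3 c u v R. g w = 0}"
  have "circle3 c u v R \<subseteq> ?A \<union> ?B" using zero by auto
  then have "infinite (?A \<union> ?B)"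
    by (rule infinite_super) (rule infinite_circle3[OF assms(1,2)])
  then have "infinite ?A \<or> infinite ?B" by (simp only: finite_Un de_Morgan_conj)
  then show ?thesis
    using pol_circle_zero[OF assms(3) _ ne(1)] pol_circle_zero[OF assms(4) _ w] ne(2) by blast
qed

lemma pol_sphere_mult_zero:
  assumes "0 < \<rho>" "pol affine_funs k f" "pol affine_funs l g"
    and zero: "\<And>w. dist p w = \<rho> \<Longrightarrow> f w * g w = 0"
    and ne: "dist p w0 = \<rho>" "f w0 \<noteq> 0" and w: "dist p w = \<rho>"
  shows "g w = 0"
proof -
  have unit: "inner ((1 / \<rho>) *\<^sub>R (z - p)) ((1 / \<rho>) *\<^sub>R (z - p)) = 1" if "dist p z = \<rho>" for z
    using that assms(1) by (simp add: dot_square_norm dist_norm norm_minus_commute power2_eq_square)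
  define u where "u = (1 / \<rho>) *\<^sub>R (w - p)"
  define x where "x = (1 / \<rho>) *\<^sub>R (w0 - p)"
  have u: "inner u u = 1" unfolding u_def by (rule unit[OF w])
  have x: "inner x x = 1" unfolding x_def by (rule unit[OF ne(1)])
  obtain v e where f: "orthonormal3 u v e" and xp: "x = inner x u *\<^sub>R u + inner x v *\<^sub>R v"
    by (rule exists_orthonormal3_plane[OF u])
  have "inner x e = 0" by (subst xp) (use f in \<open>simp add: orthonormal3_def inner_add_left\<close>)
  then have "(inner x u)\<^sup>2 + (inner x v)\<^sup>2 = 1" using orthonormal3_inner_self[OF f, of x] x by simp
  moreover have "w0 = p + (\<rho> * inner x u) *\<^sub>R u + (\<rho> * inner x v) *\<^sub>R v"
  proof -
    have "w0 = p + \<rho> *\<^sub>R x" using assms(1) by (simp add: x_def)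
    also have "\<rho> *\<^sub>R x = (\<rho> * inner x u) *\<^sub>R u + (\<rho> * inner x v) *\<^sub>R v"
      by (subst xp) (simp add: scaleR_add_right)
    finally show ?thesis by (simp add: add.assoc)
  qed
  ultimately have w0: "w0 \<in> circle3 p u v \<rho>" unfolding circle3_def by blast
  have "w \<in> circle3 p u v \<rho>" unfolding circle3_def
    using assms(1) by (intro CollectI exI[of _ 1] exI[of _ 0]) (simp add: u_def)
  moreover have "dist p z = \<rho>" if "z \<in> circle3 p u v \<rho>" for z
  proof -
    from that obtain a b where z: "z = p + (\<rho> * a) *\<^sub>R u + (\<rho> * b) *\<^sub>R v" and ab: "a\<^sup>2 + b\<^sup>2 = 1"
      by (auto simp: circle3_def)
    have "inner (z - p) (z - p) = \<rho>\<^sup>2 * (a\<^sup>2 + b\<^sup>2)"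
      using f unfolding orthonormal3_def
      by (simp add: z inner_add_left inner_add_right inner_commute[of v u] distrib_left power2_eq_square)
    then have "(dist z p)\<^sup>2 = \<rho>\<^sup>2" by (simp add: ab dist_norm power2_norm_eq_inner)
    then show ?thesis using assms(1) by (simp add: dist_commute power2_eq_iff_nonneg)
  qed
  ultimately show ?thesis using pol_circle_mult_zero[OF f assms(1-3) _ w0 ne(2)] zero by blast
qed

section \<open>Division by a circle or a sphere\<close>

lemma aff_in_frame:
  assumes "orthonormal3 u v e" "x \<in> affine_funs"
  shows "pol {\<lambda>w. inner (w - p) u, \<lambda>w. inner (w - p) v, \<lambda>w. inner (w - p) e} 1 x"
proof -
  obtain a d where x: "x = (\<lambda>p. inner p a + d)" by (rule affE[OF assms(2)])
  let ?X = "{\<lambda>w. inner (w - p) u, \<lambda>w. inner (w - p) v, \<lambda>w. inner (w - p) e}"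
  have "x w = inner (w - p) u * inner u a + inner (w - p) v * inner v a + inner (w - p) e * inner e a + (inner p a + d)" for w
  proof -
    have "inner (w - p) a = inner (inner (w - p) u *\<^sub>R u + inner (w - p) v *\<^sub>R v + inner (w - p) e *\<^sub>R e) a"
      by (subst orthonormal3_expand[OF assms(1), symmetric]) simp
    then show ?thesis by (simp add: x inner_add_left inner_diff_left)
  qed
  then have "x = (\<lambda>w. inner (w - p) u * inner u a + inner (w - p) v * inner v a + inner (w - p) e * inner e a + (inner p a + d))"
    by blast
  moreover have "pol ?X 1 \<dots>"
    by (intro pol.add pol_mult_le[OF pol.gen[of _ _ 1] pol.const[of 0]] pol.const) auto
  ultimately show ?thesis by simp
qed

lemma pol_of_frame_gens:
  "pol Y k f \<Longrightarrow> Y \<subseteq> (\<lambda>a w. inner (w - p) a) ` A \<Longrightarrow> pol affine_funs k f"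
  by (erule pol_subset) (use aff_inner_diff in blast)

lemma pol_zero_of_ball_zero:
  assumes f: "pol affine_funs k f" and "0 < r" and zero: "\<And>w. dist p w < r \<Longrightarrow> f w = 0"
  shows "f w = 0"
proof (cases "w = p")
  case False
  have "f (p + t *\<^sub>R (w - p)) = 0" for t
  proof (rule pol_line_zero[OF f])
    have "{0<..<r / norm (w - p)} \<subseteq> {t. f (p + t *\<^sub>R (w - p)) = 0}"
    proof
      fix t assume "t \<in> {0<..<r / norm (w - p)}"
      moreover have "dist p (p + t *\<^sub>R (w - p)) = \<bar>t\<bar> * norm (w - p)"
        by (subst dist_commute) (simp add: dist_norm)
      ultimately have "dist p (p + t *\<^sub>R (w - p)) < r"
        using False by (simp add: pos_less_divide_eq)
      then show "t \<in> {t. f (p + t *\<^sub>R (w - p)) = 0}" using zero by simp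
    qed
    moreover have "infinite {0<..<r / norm (w - p)}" using False assms(2) by (simp add: infinite_Ioo)
    ultimately show "infinite {t. f (p + t *\<^sub>R (w - p)) = 0}" using infinite_super by blast
  qed
  from this[of 1] show ?thesis by simp
qed (use assms in simp)

lemma abs_inner_le_dist:
  fixes p w :: "'a::real_inner"
  assumes "inner u u = 1"
  shows "\<bar>inner (w - p) u\<bar> \<le> dist p w"
  using Cauchy_Schwarz_ineq2[of "w - p" u] assms
  by (subst dist_commute) (simp add: dist_norm norm_eq_sqrt_inner[of u])

definition sphere_cap :: "real^3 \<Rightarrow> real \<Rightarrow> real \<Rightarrow> real^3 \<Rightarrow> (real^3) set" where
  "sphere_cap p \<rho> h e = {w. dist p w = \<rho> \<and> inner (w - p) e = h}"

lemma orthonormal3_dist_sq: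
  assumes "orthonormal3 u v e"
  shows "(dist p w)\<^sup>2 = (inner (w - p) u)\<^sup>2 + (inner (w - p) v)\<^sup>2 + (inner (w - p) e)\<^sup>2"
  using orthonormal3_inner_self[OF assms, of "w - p"]
  by (subst dist_commute) (simp only: dist_norm power2_norm_eq_inner)

lemma sphere_cap_eq_circle3:
  assumes "orthonormal3 u v e" "0 < \<rho>" "\<bar>h\<bar> < \<rho>"
  shows "sphere_cap p \<rho> h e = circle3 (p + h *\<^sub>R e) u v (sqrt (\<rho>\<^sup>2 - h\<^sup>2))"
proof -
  note o = assms(1)[unfolded orthonormal3_def]
  have "h\<^sup>2 < \<rho>\<^sup>2" using assms(3) by (metis abs_of_pos assms(2) power2_abs power_strict_mono abs_ge_zero pos2)
  define R where "R = sqrt (\<rho>\<^sup>2 - h\<^sup>2)"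
  have R: "0 < R" "R\<^sup>2 = \<rho>\<^sup>2 - h\<^sup>2" using \<open>h\<^sup>2 < \<rho>\<^sup>2\<close> by (auto simp: R_def)
  show ?thesis unfolding R_def[symmetric]
  proof (intro equalityI subsetI)
    fix w assume "w \<in> sphere_cap p \<rho> h e"
    then have w: "dist p w = \<rho>" "inner (w - p) e = h" by (auto simp: sphere_cap_def)
    have "(inner (w - p) u)\<^sup>2 + (inner (w - p) v)\<^sup>2 = R\<^sup>2"
      using orthonormal3_dist_sq[OF assms(1), of p w] w R by simp
    then have "(inner (w - p) u / R)\<^sup>2 + (inner (w - p) v / R)\<^sup>2 = 1"
      using R(1) by (simp add: power_divide flip: add_divide_distrib)
    moreover have "w = p + h *\<^sub>R e + (R * (inner (w - p) u / R)) *\<^sub>R u + (R * (inner (w - p) v / R)) *\<^sub>R v"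
      using orthonormal3_expand[OF assms(1), of "w - p"] w(2) R(1) by (simp add: diff_eq_eq add_ac)
    ultimately show "w \<in> circle3 (p + h *\<^sub>R e) u v R" unfolding circle3_def by blast
  next
    fix w assume "w \<in> circle3 (p + h *\<^sub>R e) u v R"
    then obtain a b where w: "w = p + h *\<^sub>R e + (R * a) *\<^sub>R u + (R * b) *\<^sub>R v" and ab: "a\<^sup>2 + b\<^sup>2 = 1"
      by (auto simp: circle3_def)
    have i: "inner (w - p) e = h" "inner (w - p) u = R * a" "inner (w - p) v = R * b"
      using o by (auto simp: w inner_add_left inner_diff_left inner_commute[of e u] inner_commute[of e v] inner_commute[of v u])
    have "(dist p w)\<^sup>2 = R\<^sup>2 * (a\<^sup>2 + b\<^sup>2) + h\<^sup>2"
      unfolding orthonormal3_dist_sq[OF assms(1)] i by (simp add: power_mult_distrib distrib_left)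
    then have "(dist p w)\<^sup>2 = \<rho>\<^sup>2" using R ab by simp
    then show "w \<in> sphere_cap p \<rho> h e"
      using i assms(2) by (simp add: sphere_cap_def power2_eq_iff_nonneg)
  qed
qed

lemma pol_div_cap:
  assumes f: "pol affine_funs k F" and e: "inner e e = 1" and "0 < \<rho>" "\<bar>h\<bar> < \<rho>"
    and zero: "\<And>w. w \<in> sphere_cap p \<rho> h e \<Longrightarrow> F w = 0"
  shows "\<exists>G. pol affine_funs (k - 1) G \<and> (\<forall>w. dist p w = \<rho> \<longrightarrow> F w = (inner (w - p) e - h) * G w)"
proof -
  obtain u v where o: "orthonormal3 u v e" by (rule exists_orthonormal3_last[OF e])
  note o' = o[unfolded orthonormal3_def]
  have h2: "h\<^sup>2 < \<rho>\<^sup>2" using assms(3,4) by (metis abs_of_pos power2_abs power_strict_mono abs_ge_zero pos2)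
  define R where "R = sqrt (\<rho>\<^sup>2 - h\<^sup>2)"
  have R: "0 < R" "R\<^sup>2 = \<rho>\<^sup>2 - h\<^sup>2" using h2 by (auto simp: R_def)
  define x where "x = (\<lambda>w. inner (w - p) u)"
  define y where "y = (\<lambda>w. inner (w - p) v)"
  define z where "z = (\<lambda>w. inner (w - p) e)"
  have gens: "{x, y, z} \<subseteq> (\<lambda>a w. inner (w - p) a) ` {u, v, e}" by (auto simp: x_def y_def z_def)
  have toaff: "pol affine_funs j g" if "pol Y j g" "Y \<subseteq> {x, y, z}" for Y j g
    by (rule pol_of_frame_gens[OF that(1)]) (use gens that in blast)
  have "pol {x, y, z} k F"
    using f unfolding x_def y_def z_def by (rule pol_subst) (rule aff_in_frame[OF o])
  then have "pol (insert z {x, y}) k F" by (rule pol_subset) auto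
  then obtain G F0 where G: "pol (insert z {x, y}) (k - 1) G" and F0: "pol {x, y} k F0"
    and F: "F = (\<lambda>p. (z p - h) * G p + F0 p)"
    using pol_div_linear by blast
  have q: "pol {y} 2 (\<lambda>w. (y w)\<^sup>2 - R\<^sup>2)"
    using pol_power[OF pol.gen[of y "{y}" 1], of 2] by (intro pol_diff pol.const) auto
  obtain H A B where H: "pol (insert x {y}) (k - 2) H" and A: "pol {y} (k - 1) A" and B: "pol {y} k B"
    and F0_eq: "F0 = (\<lambda>p. ((x p)\<^sup>2 + ((y p)\<^sup>2 - R\<^sup>2)) * H p + x p * A p + B p)"
    using pol_div_quadratic[OF F0 q] by blast
  have AB: "A w = 0 \<and> B w = 0" if "dist p w < R" for w
  proof -
    have yw: "\<bar>y w\<bar> < R" using that abs_inner_le_dist[of v w p] o' by (simp add: y_def)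
    then have "(y w)\<^sup>2 < R\<^sup>2" using R(1) by (metis abs_of_pos power2_abs power_strict_mono abs_ge_zero pos2)
    define s where "s = sqrt (R\<^sup>2 - (y w)\<^sup>2)"
    have s: "0 < s" "s\<^sup>2 = R\<^sup>2 - (y w)\<^sup>2" using \<open>(y w)\<^sup>2 < R\<^sup>2\<close> by (auto simp: s_def)
    have *: "\<sigma> * A w + B w = 0" if "\<sigma>\<^sup>2 = s\<^sup>2" for \<sigma>
    proof -
      define w' where "w' = p + \<sigma> *\<^sub>R u + y w *\<^sub>R v + h *\<^sub>R e"
      have c: "x w' = \<sigma>" "y w' = y w" "z w' = h"
        using o' by (auto simp: w'_def x_def z_def inner_add_left inner_diff_left
          inner_commute[of e u] inner_commute[of e v] inner_commute[of v u])
           (simp add: y_def inner_add_left inner_diff_left inner_commute[of e v] o')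
      have "(dist p w')\<^sup>2 = \<rho>\<^sup>2"
        unfolding orthonormal3_dist_sq[OF o] using c s R that by (simp add: x_def y_def z_def)
      then have "dist p w' = \<rho>" using assms(3) by (simp add: power2_eq_iff_nonneg)
      then have "F w' = 0" using zero c by (simp add: sphere_cap_def z_def)
      moreover have "A w' = A w" "B w' = B w"
        by (rule pol_cong_gens[OF A], use c in simp) (rule pol_cong_gens[OF B], use c in simp)
      ultimately show ?thesis unfolding F F0_eq using c that s by simp
    qed
    from *[of s] *[of "- s"] s show ?thesis by simp
  qed
  have "A w = 0" "B w = 0" for w
    using pol_zero_of_ball_zero[OF toaff[OF A] R(1), of p w] pol_zero_of_ball_zero[OF toaff[OF B] R(1), of p w] AB
    by simp_all
  then have F': "F w = (z w - h) * G w + ((x w)\<^sup>2 + (y w)\<^sup>2 - R\<^sup>2) * H w" for w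
    by (simp add: F F0_eq)
  have "pol affine_funs (k - 1) (\<lambda>w. G w - (z w + h) * H w)"
  proof (rule pol_diff)
    show "pol affine_funs (k - 1) G" by (rule toaff[OF G]) auto
    have "pol affine_funs 1 (\<lambda>w. z w + h)"
      by (intro pol.add pol.const pol.gen) (auto simp: z_def aff_inner_diff)
    moreover have "pol affine_funs (k - 2) H" by (rule toaff[OF H]) auto
    ultimately show "pol affine_funs (k - 1) (\<lambda>w. (z w + h) * H w)" by (rule pol_mult_le) simp
  qed
  moreover have "F w = (inner (w - p) e - h) * (G w - (z w + h) * H w)" if "dist p w = \<rho>" for w
  proof -
    have "\<rho>\<^sup>2 = (x w)\<^sup>2 + (y w)\<^sup>2 + (z w)\<^sup>2"
      using orthonormal3_dist_sq[OF o, of p w] that by (simp add: x_def y_def z_def)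
    then have eq: "(x w)\<^sup>2 + (y w)\<^sup>2 - R\<^sup>2 = - ((z w - h) * (z w + h))"
      using R(2) by (simp add: algebra_simps power2_eq_square)
    have zw: "inner (w - p) e = z w" by (simp add: z_def)
    show ?thesis unfolding F' eq zw by (simp add: algebra_simps)
  qed
  ultimately show ?thesis by blast
qed

lemma pol_div_sphere:
  assumes f: "pol affine_funs k F" and "0 < \<rho>" and zero: "\<And>w. dist p w = \<rho> \<Longrightarrow> F w = 0"
  shows "\<exists>H. pol affine_funs (k - 2) H \<and> (\<forall>w. F w = ((dist p w)\<^sup>2 - \<rho>\<^sup>2) * H w)"
proof -
  obtain v e where o: "orthonormal3 (axis 1 1) v e" by (rule exists_orthonormal3_first[of "axis 1 1"]) (auto simp: inner_axis_axis)
  define u where "u = (axis 1 1 :: real^3)"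
  have o: "orthonormal3 u v e" using o by (simp add: u_def)
  note o' = o[unfolded orthonormal3_def]
  define x where "x = (\<lambda>w. inner (w - p) u)"
  define y where "y = (\<lambda>w. inner (w - p) v)"
  define z where "z = (\<lambda>w. inner (w - p) e)"
  have gens: "{x, y, z} \<subseteq> (\<lambda>a w. inner (w - p) a) ` {u, v, e}" by (auto simp: x_def y_def z_def)
  have toaff: "pol affine_funs j g" if "pol Y j g" "Y \<subseteq> {x, y, z}" for Y j g
    by (rule pol_of_frame_gens[OF that(1)]) (use gens that in blast)
  have "pol {x, y, z} k F"
    using f unfolding x_def y_def z_def by (rule pol_subst) (rule aff_in_frame[OF o])
  moreover have q: "pol {y, z} 2 (\<lambda>w. (y w)\<^sup>2 + (z w)\<^sup>2 - \<rho>\<^sup>2)"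
    using pol_power[OF pol.gen[of y "{y, z}" 1], of 2] pol_power[OF pol.gen[of z "{y, z}" 1], of 2]
    by (intro pol_diff pol.add pol.const) auto
  ultimately obtain H A B where H: "pol {x, y, z} (k - 2) H" and A: "pol {y, z} (k - 1) A" and B: "pol {y, z} k B"
    and F: "F = (\<lambda>p. ((x p)\<^sup>2 + ((y p)\<^sup>2 + (z p)\<^sup>2 - \<rho>\<^sup>2)) * H p + x p * A p + B p)"
    using pol_div_quadratic by blast
  have AB: "A w = 0 \<and> B w = 0" if "dist p w < \<rho>" for w
  proof -
    have "(dist p w)\<^sup>2 < \<rho>\<^sup>2" using that by (intro power_strict_mono) auto
    then have lt: "(y w)\<^sup>2 + (z w)\<^sup>2 < \<rho>\<^sup>2"
      unfolding orthonormal3_dist_sq[OF o] y_def z_def using zero_le_power2[of "inner (w - p) u"] by linarith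
    define s where "s = sqrt (\<rho>\<^sup>2 - ((y w)\<^sup>2 + (z w)\<^sup>2))"
    have s: "0 < s" "s\<^sup>2 = \<rho>\<^sup>2 - ((y w)\<^sup>2 + (z w)\<^sup>2)" using lt by (auto simp: s_def)
    have *: "\<sigma> * A w + B w = 0" if "\<sigma>\<^sup>2 = s\<^sup>2" for \<sigma>
    proof -
      define w' where "w' = p + \<sigma> *\<^sub>R u + y w *\<^sub>R v + z w *\<^sub>R e"
      have c: "inner (w' - p) u = \<sigma>" "inner (w' - p) v = y w" "inner (w' - p) e = z w"
        using o' by (auto simp: w'_def inner_add_left inner_diff_left
          inner_commute[of e u] inner_commute[of e v] inner_commute[of v u])
      have "(dist p w')\<^sup>2 = \<rho>\<^sup>2"
        unfolding orthonormal3_dist_sq[OF o] using c s that by simp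
      then have "dist p w' = \<rho>" using assms(2) by (simp add: power2_eq_iff_nonneg)
      then have "F w' = 0" using zero by simp
      moreover have "x w' = \<sigma>" "y w' = y w" "z w' = z w" using c by (simp_all only: x_def y_def z_def)
      moreover from this have "A w' = A w" "B w' = B w"
        by (auto intro: pol_cong_gens[OF A] pol_cong_gens[OF B])
      ultimately show ?thesis unfolding F using that s by simp
    qed
    from *[of s] *[of "- s"] s show ?thesis by simp
  qed
  have "A w = 0" "B w = 0" for w
    using pol_zero_of_ball_zero[OF toaff[OF A] assms(2), of p w]
      pol_zero_of_ball_zero[OF toaff[OF B] assms(2), of p w] AB by simp_all
  then have "F w = ((dist p w)\<^sup>2 - \<rho>\<^sup>2) * H w" for w
    unfolding orthonormal3_dist_sq[OF o] by (simp add: F x_def y_def z_def)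
  moreover have "pol affine_funs (k - 2) H" by (rule toaff[OF H]) auto
  ultimately show ?thesis by blast
qed

lemma pol_zero_on_sphere_of_caps:
  assumes "finite E" "pol affine_funs k F" "k < int (card E)" "\<And>e. e \<in> E \<Longrightarrow> inner e e = 1"
    "0 < h" "h < \<rho>" "\<And>e w. e \<in> E \<Longrightarrow> w \<in> sphere_cap p \<rho> h e \<Longrightarrow> F w = 0" "dist p w = \<rho>"
  shows "F w = 0"
  using assms(1-4,7,8)
proof (induction E arbitrary: F k w rule: finite_induct)
  case empty
  then show ?case using pol_neg by auto
next
  case (insert e E)
  have \<rho>: "0 < \<rho>" "\<bar>h\<bar> < \<rho>" using assms by auto
  obtain G where G: "pol affine_funs (k - 1) G" "\<And>w. dist p w = \<rho> \<Longrightarrow> F w = (inner (w - p) e - h) * G w"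
    using pol_div_cap[OF insert.prems(1) insert.prems(3) \<rho>, of e p] insert.prems(4)[of e] by auto
  have "G w = 0"
  proof (rule insert.IH[OF G(1)])
    show "k - 1 < int (card E)" using insert by simp
    fix e' assume e': "e' \<in> E"
    show e'1: "inner e' e' = 1" using insert.prems(3) e' by simp
    fix w assume w: "w \<in> sphere_cap p \<rho> h e'"
    obtain u v where o: "orthonormal3 u v e'" by (rule exists_orthonormal3_last[OF e'1])
    note o' = o[unfolded orthonormal3_def]
    define R where "R = sqrt (\<rho>\<^sup>2 - h\<^sup>2)"
    have R: "0 < R" using assms by (simp add: R_def power_strict_mono)
    have C: "sphere_cap p \<rho> h e' = circle3 (p + h *\<^sub>R e') u v R"
      unfolding R_def by (rule sphere_cap_eq_circle3[OF o \<rho>])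
    have "\<exists>w\<in>circle3 (p + h *\<^sub>R e') u v R. inner (w - p) e - h \<noteq> 0"
    proof (rule ccontr)
      assume *: "\<not> ?thesis"
      have "p + h *\<^sub>R e' + \<sigma> *\<^sub>R (R *\<^sub>R u) \<in> circle3 (p + h *\<^sub>R e') u v R" if "\<sigma>\<^sup>2 = 1" for \<sigma>
        unfolding circle3_def using that by (intro CollectI exI[of _ \<sigma>] exI[of _ 0]) (simp add: mult.commute)
      then have "h * inner e' e + \<sigma> * (R * inner u e) = h" if "\<sigma>\<^sup>2 = 1" for \<sigma>
        using * that by (fastforce simp: inner_add_left)
      from this[of 1] this[of "-1"] have "h * inner e' e + R * inner u e = h" "h * inner e' e - R * inner u e = h"
        by simp_all
      then have "h * inner e' e = h" by linarith
      then have "inner e' e = 1" using assms(5) by simp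
      then have "inner (e' - e) (e' - e) = 0"
        using e'1 insert.prems(3)[of e] by (simp add: inner_diff_left inner_diff_right inner_commute[of e e'])
      then show False using e' insert.hyps by simp
    qed
    then obtain w0 where w0: "w0 \<in> circle3 (p + h *\<^sub>R e') u v R" "inner (w0 - p) e - h \<noteq> 0" by blast
    have l: "pol affine_funs 1 (\<lambda>w. inner (w - p) e - h)"
      by (intro pol_diff pol.const pol.gen aff_inner_diff) auto
    show "G w = 0"
    proof (rule pol_circle_mult_zero[OF o R l G(1) _ w0 w[unfolded C]])
      fix w assume "w \<in> circle3 (p + h *\<^sub>R e') u v R"
      then have w: "w \<in> sphere_cap p \<rho> h e'" by (simp add: C)
      then have "F w = 0" using insert.prems(4) e' by blast
      then show "(inner (w - p) e - h) * G w = 0" using G(2) w by (simp add: sphere_cap_def)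
    qed
  qed (use insert.prems in auto)
  then show ?case using G(2) insert.prems(5) by simp
qed

lemma pol_zero_of_spheres:
  assumes "finite \<Sigma>" "pol affine_funs k F" "k < 2 * int (card \<Sigma>)" "\<And>p \<rho>. (p, \<rho>) \<in> \<Sigma> \<Longrightarrow> 0 < \<rho>"
    "\<And>p \<rho> w. (p, \<rho>) \<in> \<Sigma> \<Longrightarrow> dist p w = \<rho> \<Longrightarrow> F w = 0"
  shows "F w = 0"
  using assms
proof (induction \<Sigma> arbitrary: F k w rule: finite_induct)
  case empty
  then show ?case using pol_neg by auto
next
  case (insert s \<Sigma>)
  obtain p \<rho> where s: "s = (p, \<rho>)" by (cases s)
  have \<rho>: "0 < \<rho>" using insert.prems(3)[of p \<rho>] s by simp
  obtain H where H: "pol affine_funs (k - 2) H" "\<And>w. F w = ((dist p w)\<^sup>2 - \<rho>\<^sup>2) * H w"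
    using pol_div_sphere[OF insert.prems(1) \<rho>, of p] insert.prems(4)[of p \<rho>] s by auto
  have sq: "pol affine_funs 2 (\<lambda>w. (dist p w)\<^sup>2 - \<rho>\<^sup>2)"
  proof -
    obtain v e where o: "orthonormal3 (axis 1 1) v e" by (rule exists_orthonormal3_first[of "axis 1 1"]) (auto simp: inner_axis_axis)
    have "pol affine_funs 2 (\<lambda>w. (inner (w - p) a)\<^sup>2)" for a
      using pol_power[OF pol.gen[OF aff_inner_diff[of p a]], of 1 2] by simp
    then show ?thesis
      unfolding orthonormal3_dist_sq[OF o] by (intro pol_diff pol.add pol.const) auto
  qed
  have "H w = 0"
  proof (rule insert.IH[OF H(1)])
    show "k - 2 < 2 * int (card \<Sigma>)" using insert by simp
    fix p' \<rho>' assume s': "(p', \<rho>') \<in> \<Sigma>"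
    show \<rho>': "0 < \<rho>'" using insert.prems(3)[of p' \<rho>'] s' by simp
    fix w assume w: "dist p' w = \<rho>'"
    have "\<exists>w. dist p' w = \<rho>' \<and> (dist p w)\<^sup>2 - \<rho>\<^sup>2 \<noteq> 0"
    proof (rule ccontr)
      assume *: "\<not> ?thesis"
      have exp: "(norm (p' - p))\<^sup>2 + 2 * \<sigma> * \<rho>' * inner (p' - p) u + \<rho>'\<^sup>2 = \<rho>\<^sup>2"
        if u: "inner u u = 1" and \<sigma>: "\<sigma>\<^sup>2 = 1" for \<sigma> u
      proof -
        have "norm u = 1" using u by (simp add: norm_eq_sqrt_inner)
        moreover have "\<bar>\<sigma>\<bar> = 1" using \<sigma> by (auto simp: power2_eq_1_iff)
        ultimately have "dist p' (p' + (\<sigma> * \<rho>') *\<^sub>R u) = \<rho>'"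
          using \<rho>' by (simp add: dist_norm abs_mult)
        then have "(dist p (p' + (\<sigma> * \<rho>') *\<^sub>R u))\<^sup>2 = \<rho>\<^sup>2" using * by auto
        moreover have "(dist p (p' + (\<sigma> * \<rho>') *\<^sub>R u))\<^sup>2
            = inner ((p' - p) + (\<sigma> * \<rho>') *\<^sub>R u) ((p' - p) + (\<sigma> * \<rho>') *\<^sub>R u)"
          by (subst dist_commute) (simp add: dist_norm diff_add_eq flip: power2_norm_eq_inner)
        moreover have "\<dots> = (norm (p' - p))\<^sup>2 + 2 * \<sigma> * \<rho>' * inner (p' - p) u + \<sigma>\<^sup>2 * \<rho>'\<^sup>2"
        proof -
          define d where "d = p' - p"
          show ?thesis
            unfolding d_def[symmetric] power2_norm_eq_inner inner_add_left inner_add_right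
              inner_scaleR_left inner_scaleR_right inner_commute[of u d] u
            by (simp add: power2_eq_square distrib_left)
        qed
        ultimately show ?thesis using \<sigma> by simp
      qed
      have perp: "inner (p' - p) u = 0" if "inner u u = 1" for u
      proof -
        define x where "x = 2 * \<rho>' * inner (p' - p) u"
        have "(norm (p' - p))\<^sup>2 + x + \<rho>'\<^sup>2 = \<rho>\<^sup>2" "(norm (p' - p))\<^sup>2 - x + \<rho>'\<^sup>2 = \<rho>\<^sup>2"
          using exp[OF that, of 1] exp[OF that, of "-1"] by (simp_all add: x_def)
        then have "x = 0" by linarith
        then show ?thesis using \<rho>' by (simp add: x_def)
      qed
      have "p' = p"
      proof (rule ccontr)
        assume "p' \<noteq> p"
        then have "inner ((1 / norm (p' - p)) *\<^sub>R (p' - p)) ((1 / norm (p' - p)) *\<^sub>R (p' - p)) = 1"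
          by (simp add: dot_square_norm power2_eq_square)
        from perp[OF this] \<open>p' \<noteq> p\<close> show False by simp
      qed
      moreover have "\<rho>' = \<rho>"
        using exp[of "axis 1 1" 1] \<open>p' = p\<close> \<rho> \<rho>' by (simp add: inner_axis_axis power2_eq_iff_nonneg)
      ultimately show False using s s' insert.hyps by simp
    qed
    then obtain w0 where w0: "dist p' w0 = \<rho>'" "(dist p w0)\<^sup>2 - \<rho>\<^sup>2 \<noteq> 0" by blast
    show "H w = 0"
    proof (rule pol_sphere_mult_zero[OF \<rho>' sq H(1) _ w0 w])
      fix w assume "dist p' w = \<rho>'"
      then show "((dist p w)\<^sup>2 - \<rho>\<^sup>2) * H w = 0" 
        using insert.prems(4)[of p' \<rho>' w] s' H(2)[of w] by simp
    qed
  qed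
  then show ?case using H(2) by simp
qed

section \<open>Points on a circle cut by a polynomial\<close>

definition triples :: "('b \<Rightarrow> 'b \<Rightarrow> bool) \<Rightarrow> 'b set \<Rightarrow> ('b \<times> 'b \<times> 'b) set" where
  "triples R X = {(a, b, c). a \<in> X \<and> b \<in> X \<and> c \<in> X \<and> a \<noteq> b \<and> a \<noteq> c \<and> b \<noteq> c \<and> R a b \<and> R a c}"

lemma finite_triples: "finite X \<Longrightarrow> finite (triples R X)"
  by (rule finite_subset[of _ "X \<times> X \<times> X"]) (auto simp: triples_def)

lemma card_le_triples:
  assumes fin: "finite X" and R: "\<And>a b. a \<in> X \<Longrightarrow> b \<in> X \<Longrightarrow> R a b"
  shows "card X \<le> 2 + card (triples R X)"
proof (cases "card X \<le> 2")
  case False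
  then have "X \<noteq> {}" by auto
  then obtain a where a: "a \<in> X" by blast
  have "card (X - {a}) \<noteq> 0" using False a fin by simp
  then have "X - {a} \<noteq> {}" by (metis card.empty)
  then obtain b where b: "b \<in> X - {a}" by blast
  have "inj_on (\<lambda>c. (a, b, c)) (X - {a, b})" by (auto intro: inj_onI)
  moreover have "(\<lambda>c. (a, b, c)) ` (X - {a, b}) \<subseteq> triples R X"
    using a b R by (auto simp: triples_def)
  ultimately have "card (X - {a, b}) \<le> card (triples R X)"
    using card_inj_on_le finite_triples[OF fin] by blast
  moreover have "card (X - {a, b}) = card X - 2"
    using a b fin by (subst card_Diff_subset) auto
  ultimately show ?thesis by simp
qed simp

lemma continuous_on_circle_param: "continuous_on A (circle_param c u v R)"
proof -
  have "1 + t\<^sup>2 \<noteq> 0" for t :: real using one_plus_square_pos[of t] by simp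
  then show ?thesis unfolding circle_param_def by (intro continuous_intros) auto
qed

lemma circle_points_bound_aux:
  assumes f: "pol affine_funs k f" and ne: "f (circle_param c u v R t0) \<noteq> 0"
    and P: "finite P" "P \<subseteq> circle3 c u v R"
  shows "card P \<le> 6 * nat k + 3 + card (triples (connected_component {w. f w \<noteq> 0}) P)"
proof -
  let ?\<gamma> = "circle_param c u v R" and ?conn = "connected_component {w. f w \<noteq> 0}"
  obtain g where g: "Polynomial.degree g \<le> 2 * nat k"
    "\<And>t. poly g t = (1 + t\<^sup>2) ^ nat k * f (?\<gamma> t)"
    by (rule pol_restrict_circle[OF f]) blast
  have nz: "1 + t\<^sup>2 \<noteq> 0" for t :: real using one_plus_square_pos[of t] by simp
  then have g0: "poly g t = 0 \<longleftrightarrow> f (?\<gamma> t) = 0" for t by (simp add: g(2))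
  have "g \<noteq> 0" using g0[of t0] ne by auto
  define Z where "Z = {t. poly g t = 0}"
  have finZ: "finite Z" and cardZ: "card Z \<le> 2 * nat k"
    unfolding Z_def using \<open>g \<noteq> 0\<close> poly_roots_finite card_poly_roots_bound[of g] g(1) by auto
  define before where "before = (\<lambda>t. card {z \<in> Z. z < t})"
  have before_le: "before t \<le> 2 * nat k" for t
    unfolding before_def using cardZ card_mono[OF finZ, of "{z \<in> Z. z < t}"] by simp
  define \<tau> where "\<tau> = (\<lambda>w. SOME t. ?\<gamma> t = w)"
  have \<tau>: "?\<gamma> (\<tau> w) = w" if "w \<in> range ?\<gamma>" for w
    using that unfolding \<tau>_def by (auto intro: someI)
  define X where "X = (\<lambda>i. {w \<in> P. w \<in> range ?\<gamma> \<and> f w \<noteq> 0 \<and> before (\<tau> w) = i})"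
  have conn_le: "?conn (?\<gamma> s) (?\<gamma> t)"
    if st: "s \<le> t" "f (?\<gamma> s) \<noteq> 0" "f (?\<gamma> t) \<noteq> 0" "before s = before t" for s t
  proof -
    have "f (?\<gamma> z) \<noteq> 0" if z: "z \<in> {s..t}" for z
    proof
      assume fz: "f (?\<gamma> z) = 0"
      then have "z \<in> Z" by (simp add: Z_def g0)
      moreover have "z \<noteq> s" "z \<noteq> t" using fz st by auto
      ultimately have "z \<in> {z \<in> Z. z < t} - {z \<in> Z. z < s}" using z by auto
      moreover have "{z \<in> Z. z < s} \<subseteq> {z \<in> Z. z < t}" using st(1) by auto
      ultimately have "{z \<in> Z. z < s} \<subset> {z \<in> Z. z < t}" by blast
      then have "before s < before t" unfolding before_def using finZ by (intro psubset_card_mono) auto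
      then show False using st(4) by simp
    qed
    moreover have "connected (?\<gamma> ` {s..t})"
      by (intro connected_continuous_image continuous_on_circle_param) auto
    ultimately show ?thesis
      unfolding connected_component_def using st(1) by (intro exI[of _ "?\<gamma> ` {s..t}"]) auto
  qed
  have conn: "?conn w w'" if "w \<in> X i" "w' \<in> X i" for w w' i
  proof -
    have *: "w \<in> range ?\<gamma>" "w' \<in> range ?\<gamma>" "f w \<noteq> 0" "f w' \<noteq> 0" "before (\<tau> w) = before (\<tau> w')"
      using that by (auto simp: X_def)
    show ?thesis
    proof (cases "\<tau> w \<le> \<tau> w'")
      case True
      then show ?thesis using conn_le[of "\<tau> w" "\<tau> w'"] * by (simp add: \<tau>)
    next
      case False
      then show ?thesis using conn_le[of "\<tau> w'" "\<tau> w"] * by (simp add: \<tau> connected_component_sym)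
    qed
  qed
  have finX: "finite (X i)" for i using P(1) by (simp add: X_def)
  have "P \<subseteq> insert (c - R *\<^sub>R u) (?\<gamma> ` Z) \<union> (\<Union>i\<in>{..2 * nat k}. X i)"
  proof
    fix w assume w: "w \<in> P"
    then consider "w = c - R *\<^sub>R u" | "w \<in> range ?\<gamma>" "f w = 0" | "w \<in> range ?\<gamma>" "f w \<noteq> 0"
      using P(2) unfolding circle3_eq by blast
    then show "w \<in> insert (c - R *\<^sub>R u) (?\<gamma> ` Z) \<union> (\<Union>i\<in>{..2 * nat k}. X i)"
    proof cases
      case 2
      then show ?thesis by (auto simp: Z_def g0)
    next
      case 3
      then have "w \<in> X (before (\<tau> w))" using w by (simp add: X_def)
      then show ?thesis using before_le by blast
    qed simp
  qed
  then have "card P \<le> card (insert (c - R *\<^sub>R u) (?\<gamma> ` Z) \<union> (\<Union>i\<in>{..2 * nat k}. X i))"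
    using finZ finX by (intro card_mono) auto
  also have "\<dots> \<le> card (insert (c - R *\<^sub>R u) (?\<gamma> ` Z)) + card (\<Union>i\<in>{..2 * nat k}. X i)"
    by (rule card_Un_le)
  also have "card (insert (c - R *\<^sub>R u) (?\<gamma> ` Z)) \<le> Suc (card (?\<gamma> ` Z))"
    by (rule card_insert_le_m1[THEN order_trans]) (use finZ in auto)
  also have "card (?\<gamma> ` Z) \<le> 2 * nat k"
    using card_image_le[OF finZ, of ?\<gamma>] cardZ by linarith
  also have "card (\<Union>i\<in>{..2 * nat k}. X i) \<le> (\<Sum>i\<in>{..2 * nat k}. card (X i))"
    by (rule card_UN_le) simp
  also have "\<dots> \<le> (\<Sum>i\<in>{..2 * nat k}. 2 + card (triples ?conn (X i)))"
    by (intro sum_mono card_le_triples finX conn)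
  also have "\<dots> = 4 * nat k + 2 + (\<Sum>i\<in>{..2 * nat k}. card (triples ?conn (X i)))"
    by (subst sum.distrib) simp
  also have "(\<Sum>i\<in>{..2 * nat k}. card (triples ?conn (X i))) = card (\<Union>i\<in>{..2 * nat k}. triples ?conn (X i))"
    by (rule card_UN_disjoint[symmetric]) (auto simp: finite_triples finX, auto simp: triples_def X_def)
  also have "\<dots> \<le> card (triples ?conn P)"
    using P(1) by (intro card_mono finite_triples) (auto simp: triples_def X_def)
  finally show ?thesis by simp
qed

lemma circle_points_bound:
  assumes f: "pol affine_funs k f" and w0: "w0 \<in> circle3 c u v R" "f w0 \<noteq> 0"
    and P: "finite P" "P \<subseteq> circle3 c u v R"
  shows "card P \<le> 6 * nat k + 3 + card (triples (connected_component {w. f w \<noteq> 0}) P)"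
proof (cases "w0 \<in> range (circle_param c u v R)")
  case True
  then obtain t where "w0 = circle_param c u v R t" by blast
  then show ?thesis using circle_points_bound_aux[OF f _ P] w0(2) by simp
next
  case False
  then have "w0 = circle_param c (- u) v R 0" using w0(1) by (auto simp: circle3_eq circle_param_def)
  then show ?thesis using circle_points_bound_aux[OF f, of c "- u" v R 0 P] w0(2) P by (simp add: circle3_minus)
qed

lemma sum_card_almost_disjoint:
  assumes "finite Q" "\<And>q. q \<in> Q \<Longrightarrow> finite (X q)"
    and "\<And>q q'. q \<in> Q \<Longrightarrow> q' \<in> Q \<Longrightarrow> q \<noteq> q' \<Longrightarrow> card (X q \<inter> X q') \<le> 2"
  shows "(\<Sum>q\<in>Q. card (X q)) \<le> card (\<Union>q\<in>Q. X q) + 2 * (card Q)\<^sup>2"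
  using assms
proof (induction Q rule: finite_induct)
  case (insert q Q)
  let ?U = "\<Union>q\<in>Q. X q"
  have finU: "finite ?U" "finite (X q)" using insert by auto
  have "card (X q \<inter> ?U) = card (\<Union>q'\<in>Q. X q \<inter> X q')" by (rule arg_cong[of _ _ card]) auto
  also have "\<dots> \<le> (\<Sum>q'\<in>Q. card (X q \<inter> X q'))" using insert.hyps(1) by (rule card_UN_le)
  also have "\<dots> \<le> (\<Sum>q'\<in>Q. 2)"
  proof (rule sum_mono)
    fix q' assume "q' \<in> Q"
    then show "card (X q \<inter> X q') \<le> 2" using insert.prems(2)[of q q'] insert.hyps(2) by auto
  qed
  finally have "card (X q \<inter> ?U) \<le> 2 * card Q" by simp
  moreover have "card (X q) + card ?U = card (X q \<union> ?U) + card (X q \<inter> ?U)"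
    using finU by (intro card_Un_Int)
  moreover have "(\<Sum>q\<in>Q. card (X q)) \<le> card ?U + 2 * (card Q)\<^sup>2"
    using insert.prems by (intro insert.IH) auto
  moreover have "2 * (card (insert q Q))\<^sup>2 \<ge> 2 * (card Q)\<^sup>2 + 2 * card Q"
    using insert.hyps by (simp add: power2_eq_square)
  ultimately show ?case using insert.hyps by simp
qed simp

lemma sum_card_swap:
  assumes "finite A" "finite B"
  shows "(\<Sum>x\<in>A. card {y \<in> B. R x y}) = (\<Sum>y\<in>B. card {x \<in> A. R x y})"
  using sum.swap_restrict[OF assms, of "\<lambda>_ _. 1::nat" R] by simp

section \<open>The circle of third vertices\<close>

lemma orthogonal_to_cross:
  fixes a b e :: "real^3"
  assumes "inner e a = 0" "inner e b = 0" "e \<noteq> 0"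
  obtains s where "cross3 a b = s *\<^sub>R e"
proof -
  have "cross3 e (cross3 a b) = 0" using assms by (simp add: Lagrange)
  then have "collinear {0, e, cross3 a b}" by (simp add: cross_eq_0)
  then have "e = 0 \<or> cross3 a b = 0 \<or> (\<exists>c. cross3 a b = c *\<^sub>R e)" by (simp add: collinear_lemma)
  then consider "cross3 a b = 0" | c where "cross3 a b = c *\<^sub>R e" using assms(3) by blast
  then show thesis using that[of 0] that by cases auto
qed

lemma cross_chords_nonzero:
  fixes c :: "real^3"
  assumes dist: "dist c x = \<rho>" "dist c y = \<rho>" "dist c z = \<rho>" and ne: "x \<noteq> y" "x \<noteq> z" "y \<noteq> z"
  shows "cross3 (y - x) (z - x) \<noteq> 0"
proof
  assume "cross3 (y - x) (z - x) = 0"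
  then have "collinear {0, y - x, z - x}" by (simp add: cross_eq_0)
  then obtain s where s: "z - x = s *\<^sub>R (y - x)" using ne by (auto simp: collinear_lemma)
  define a where "a = y - x"
  have on: "2 * t * inner (x - c) a + t\<^sup>2 * inner a a = 0" if "dist c (x + t *\<^sub>R a) = \<rho>" for t
  proof -
    have "inner ((x - c) + t *\<^sub>R a) ((x - c) + t *\<^sub>R a) = inner (x - c) (x - c)"
    proof -
      have "dist (x + t *\<^sub>R a) c = dist x c" using that dist(1) by (simp add: dist_commute)
      then have "norm ((x - c) + t *\<^sub>R a) = norm (x - c)" by (simp add: dist_norm diff_add_eq)
      then show ?thesis by (simp flip: power2_norm_eq_inner)
    qed
    moreover have "inner ((x - c) + t *\<^sub>R a) ((x - c) + t *\<^sub>R a)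
        = inner (x - c) (x - c) + (2 * t * inner (x - c) a + t\<^sup>2 * inner a a)"
      unfolding inner_add_left inner_add_right inner_scaleR_left inner_scaleR_right inner_commute[of a "x - c"]
      by (simp add: power2_eq_square distrib_left)
    ultimately show ?thesis by simp
  qed
  define m where "m = inner a a"
  have m: "m \<noteq> 0" using ne(1) by (simp add: m_def a_def)
  have "x + 1 *\<^sub>R a = y" "x + s *\<^sub>R a = z" using s by (simp_all add: a_def algebra_simps)
  then have "2 * inner (x - c) a + m = 0" "2 * s * inner (x - c) a + s\<^sup>2 * m = 0"
    using on[of 1] on[of s] dist by (simp_all add: m_def)
  then have "s * (2 * inner (x - c) a + m) = 0" "s * (2 * inner (x - c) a) + s\<^sup>2 * m = 0"
    by (simp_all add: mult_ac)
  then have "s\<^sup>2 * m = s * m" unfolding distrib_left by linarith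
  then have "s * (s - 1) * m = 0" by (simp add: algebra_simps power2_eq_square)
  then have "s = 0 \<or> s = 1" using m by simp
  then show False using s ne by auto
qed

lemma sphere_cap_three_points:
  assumes r: "{x, y, z} \<subseteq> sphere_cap p \<rho> h e" "{x, y, z} \<subseteq> sphere_cap p' \<rho>' h' e'"
    and ne: "x \<noteq> y" "x \<noteq> z" "y \<noteq> z" and e: "inner e e = 1" "inner e' e' = 1"
  shows "(e' = e \<or> e' = - e) \<and> p' + h' *\<^sub>R e' = p + h *\<^sub>R e \<and> \<rho>'\<^sup>2 - h'\<^sup>2 = \<rho>\<^sup>2 - h\<^sup>2"
proof -
  define n where "n = cross3 (y - x) (z - x)"
  have n: "n \<noteq> 0" unfolding n_def
    using r(1) by (intro cross_chords_nonzero[of p x \<rho> y z] ne) (auto simp: sphere_cap_def)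
  have perp: "inner e (y - x) = 0 \<and> inner e (z - x) = 0"
    if "{x, y, z} \<subseteq> sphere_cap p \<rho> h e" for p \<rho> h e
    using that by (auto simp: sphere_cap_def inner_diff_left inner_diff_right inner_commute)
  have "e \<noteq> 0" "e' \<noteq> 0" using e by auto
  obtain s where s: "n = s *\<^sub>R e" unfolding n_def
    using orthogonal_to_cross[of e "y - x" "z - x"] perp[OF r(1)] \<open>e \<noteq> 0\<close> by blast
  obtain s' where s': "n = s' *\<^sub>R e'" unfolding n_def
    using orthogonal_to_cross[of e' "y - x" "z - x"] perp[OF r(2)] \<open>e' \<noteq> 0\<close> by blast
  have s0: "s \<noteq> 0" "s' \<noteq> 0" using n s s' by auto
  have e'_eq: "e' = (s / s') *\<^sub>R e"
  proof -
    have "(1 / s') *\<^sub>R n = (s / s') *\<^sub>R e" unfolding s by simp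
    moreover have "(1 / s') *\<^sub>R n = e'" unfolding s' using s0 by simp
    ultimately show ?thesis by simp
  qed
  have "inner e' e' = (s / s')\<^sup>2" unfolding e'_eq using e(1) by (simp add: power2_eq_square)
  then have "(s / s')\<^sup>2 = 1" using e(2) by simp
  then have ee: "e' = e \<or> e' = - e" using e'_eq by (auto simp: power2_eq_1_iff)
  define c where "c = p + h *\<^sub>R e"
  define c' where "c' = p' + h' *\<^sub>R e'"
  have centre: "inner (w - (p + h *\<^sub>R e)) e = 0 \<and> inner (w - (p + h *\<^sub>R e)) (w - (p + h *\<^sub>R e)) = \<rho>\<^sup>2 - h\<^sup>2"
    if "w \<in> sphere_cap p \<rho> h e" "inner e e = 1" for w p \<rho> h e
  proof -
    have "dist w p = \<rho>" using that(1) by (simp add: sphere_cap_def dist_commute)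
    then have w: "inner (w - p) e = h" "inner (w - p) (w - p) = \<rho>\<^sup>2"
      using that(1) by (auto simp: sphere_cap_def dist_norm power2_norm_eq_inner)
    define d where "d = w - p"
    have "w - (p + h *\<^sub>R e) = d - h *\<^sub>R e" by (simp add: d_def)
    then show ?thesis using w[folded d_def] that(2)
      by (simp only:) (simp add: inner_diff_left inner_diff_right inner_commute[of e d] power2_eq_square)
  qed
  have C: "inner (w - c) e = 0" "inner (w - c) (w - c) = \<rho>\<^sup>2 - h\<^sup>2" if "w \<in> {x, y, z}" for w
    using centre[of w p \<rho> h e] that r(1) e(1) unfolding c_def by auto
  have C': "inner (w - c') e' = 0" "inner (w - c') (w - c') = \<rho>'\<^sup>2 - h'\<^sup>2" if "w \<in> {x, y, z}" for w
    using centre[of w p' \<rho>' h' e'] that r(2) e(2) unfolding c'_def by auto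
  define d where "d = c' - c"
  have expand: "inner (w - c') (w - c') = inner (w - c) (w - c) - 2 * inner d (w - c) + inner d d" for w
  proof -
    define b where "b = w - c"
    have "w - c' = b - d" by (simp add: b_def d_def)
    then show ?thesis unfolding b_def[symmetric]
      by (simp add: inner_diff_left inner_diff_right inner_commute[of b d])
  qed
  have "inner d (w - c) = (inner d d + (\<rho>\<^sup>2 - h\<^sup>2) - (\<rho>'\<^sup>2 - h'\<^sup>2)) / 2" if "w \<in> {x, y, z}" for w
    using C(2)[OF that] C'(2)[OF that] expand[of w] by simp
  from this[of x] this[of y] this[of z]
  have "inner d (y - c) = inner d (x - c)" "inner d (z - c) = inner d (x - c)" by simp_all
  then have "inner d (y - x) = 0" "inner d (z - x) = 0"
    by (simp_all add: inner_diff_right)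
  have de: "inner d e = 0"
  proof -
    have "inner (x - c') e = 0" using C'(1)[of x] ee by auto
    moreover have "d = (x - c) - (x - c')" by (simp add: d_def)
    ultimately show ?thesis using C(1)[of x] by (simp only: inner_diff_left) simp
  qed
  have "d = 0"
  proof (rule ccontr)
    assume "d \<noteq> 0"
    then obtain t where "n = t *\<^sub>R d" unfolding n_def
      using orthogonal_to_cross[of d "y - x" "z - x"] \<open>inner d (y - x) = 0\<close> \<open>inner d (z - x) = 0\<close> by blast
    then have "inner n e = 0" using de by simp
    then show False using s s0 e(1) by simp
  qed
  then have cc: "c' = c" by (simp add: d_def)
  then have "\<rho>'\<^sup>2 - h'\<^sup>2 = \<rho>\<^sup>2 - h\<^sup>2" using C(2)[of x] C'(2)[of x] by simp
  then show ?thesis using ee cc unfolding c_def c'_def by simp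
qed

definition direction :: "real^3 \<Rightarrow> real^3 \<Rightarrow> real^3" where
  "direction p q = (1 / dist p q) *\<^sub>R (q - p)"

lemma direction_unit: "p \<noteq> q \<Longrightarrow> inner (direction p q) (direction p q) = 1"
  by (simp add: direction_def dist_norm norm_minus_commute dot_square_norm power2_eq_square)

lemma direction_target: "p \<noteq> q \<Longrightarrow> q = p + dist p q *\<^sub>R direction p q"
  by (simp add: direction_def)

definition apexes :: "real \<Rightarrow> real \<Rightarrow> real^3 \<Rightarrow> real^3 \<Rightarrow> (real^3) set" where
  "apexes \<alpha> \<beta> p q = {r. dist p r = \<alpha> * dist p q \<and> dist q r = \<beta> * dist p q}"

text \<open>The third vertex projects orthogonally to the point \<open>p + \<eta> (q - p)\<close> of the line \<open>pq\<close>.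
  If \<open>\<eta>\<close> is zero, then \<open>q\<close> and its reflection in \<open>p\<close> define the same circle.  This is excluded by
  interchanging \<open>p\<close> and \<open>q\<close> if necessary.\<close>

locale triangle_ratios =
  fixes \<alpha> \<beta> \<eta> :: real
  assumes \<alpha>: "0 < \<alpha>" and \<beta>: "0 < \<beta>" and \<eta>_def: "\<eta> = (\<alpha>\<^sup>2 - \<beta>\<^sup>2 + 1) / 2" and \<eta>: "0 < \<eta>" "\<eta> < \<alpha>"
begin

lemma apexes_eq_cap:
  assumes "p \<noteq> q"
  shows "apexes \<alpha> \<beta> p q = sphere_cap p (\<alpha> * dist p q) (\<eta> * dist p q) (direction p q)"
proof -
  define \<delta> where "\<delta> = dist p q"
  have \<delta>: "0 < \<delta>" using assms by (simp add: \<delta>_def)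
  have "dist q r = \<beta> * \<delta> \<longleftrightarrow> inner (r - p) (direction p q) = \<eta> * \<delta>" if r: "dist p r = \<alpha> * \<delta>" for r
  proof -
    define a where "a = r - p"
    define e where "e = direction p q"
    have ee: "inner e e = 1" unfolding e_def by (rule direction_unit[OF assms])
    have "r - q = a - \<delta> *\<^sub>R e"
      unfolding a_def e_def \<delta>_def by (subst direction_target[OF assms]) simp
    then have "(dist q r)\<^sup>2 = inner (a - \<delta> *\<^sub>R e) (a - \<delta> *\<^sub>R e)"
      by (subst dist_commute) (simp add: dist_norm power2_norm_eq_inner)
    also have "\<dots> = inner a a - 2 * \<delta> * inner a e + \<delta>\<^sup>2"
      using ee by (simp add: inner_diff_left inner_diff_right inner_commute[of e a] right_diff_distrib power2_eq_square)
    also have "inner a a = (\<alpha> * \<delta>)\<^sup>2"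
      unfolding r[symmetric] by (subst dist_commute) (simp add: dist_norm power2_norm_eq_inner a_def)
    finally have eq: "(dist q r)\<^sup>2 = (\<alpha> * \<delta>)\<^sup>2 - 2 * \<delta> * inner a e + \<delta>\<^sup>2" .
    have "dist q r = \<beta> * \<delta> \<longleftrightarrow> (dist q r)\<^sup>2 = (\<beta> * \<delta>)\<^sup>2"
      using \<beta> \<delta> by (simp add: power2_eq_iff_nonneg)
    also have "\<dots> \<longleftrightarrow> 2 * \<delta> * inner a e = 2 * \<delta> * (\<eta> * \<delta>)"
      unfolding eq \<eta>_def by (auto simp: power_mult_distrib algebra_simps power2_eq_square)
    also have "\<dots> \<longleftrightarrow> inner a e = \<eta> * \<delta>" using \<delta> by simp
    finally show ?thesis unfolding a_def e_def .
  qed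
  then show ?thesis unfolding apexes_def sphere_cap_def \<delta>_def by blast
qed

lemma apexes_three_points:
  assumes pq: "p \<noteq> q" "p' \<noteq> q'" and r: "{x, y, z} \<subseteq> apexes \<alpha> \<beta> p q" "{x, y, z} \<subseteq> apexes \<alpha> \<beta> p' q'"
    and ne: "x \<noteq> y" "x \<noteq> z" "y \<noteq> z"
  shows "direction p' q' = direction p q \<or> direction p' q' = - direction p q"
    "dist p' q' = dist p q"
    "p' + (\<eta> * dist p q) *\<^sub>R direction p' q' = p + (\<eta> * dist p q) *\<^sub>R direction p q"
proof -
  have *: "(direction p' q' = direction p q \<or> direction p' q' = - direction p q) \<and>
    p' + (\<eta> * dist p' q') *\<^sub>R direction p' q' = p + (\<eta> * dist p q) *\<^sub>R direction p q \<and>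
    (\<alpha> * dist p' q')\<^sup>2 - (\<eta> * dist p' q')\<^sup>2 = (\<alpha> * dist p q)\<^sup>2 - (\<eta> * dist p q)\<^sup>2"
    by (rule sphere_cap_three_points[OF _ _ ne]) (use r pq in \<open>auto simp: apexes_eq_cap direction_unit\<close>)
  show "direction p' q' = direction p q \<or> direction p' q' = - direction p q" using * by blast
  have "(\<alpha>\<^sup>2 - \<eta>\<^sup>2) * (dist p' q')\<^sup>2 = (\<alpha>\<^sup>2 - \<eta>\<^sup>2) * (dist p q)\<^sup>2"
    using * by (simp add: power_mult_distrib algebra_simps)
  moreover have "\<alpha>\<^sup>2 - \<eta>\<^sup>2 \<noteq> 0" using \<eta> by (simp add: power2_eq_iff_nonneg)
  ultimately show d: "dist p' q' = dist p q" by (simp add: power2_eq_iff_nonneg)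
  show "p' + (\<eta> * dist p q) *\<^sub>R direction p' q' = p + (\<eta> * dist p q) *\<^sub>R direction p q"
    using * d by metis
qed

lemma apexes_inj:
  assumes "p \<noteq> q" "p \<noteq> q'" "{x, y, z} \<subseteq> apexes \<alpha> \<beta> p q" "{x, y, z} \<subseteq> apexes \<alpha> \<beta> p q'"
    and "x \<noteq> y" "x \<noteq> z" "y \<noteq> z"
  shows "q' = q"
proof -
  note * = apexes_three_points[OF assms]
  have "direction p q' = direction p q" using *(3) \<eta>(1) assms(1) by auto
  then show ?thesis using direction_target[OF assms(1)] direction_target[OF assms(2)] *(2) by simp
qed

lemma card_pairs_three_points:
  assumes ne: "x \<noteq> y" "x \<noteq> z" "y \<noteq> z" and fin: "finite A"
    and A: "\<And>p q. (p, q) \<in> A \<Longrightarrow> p \<noteq> q \<and> {x, y, z} \<subseteq> apexes \<alpha> \<beta> p q"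
  shows "card A \<le> 2"
proof (cases "A = {}")
  case False
  then obtain p q where pq: "(p, q) \<in> A" by auto
  define e where "e = direction p q"
  define c where "c = p + (\<eta> * dist p q) *\<^sub>R e"
  define g where "g = (\<lambda>e'. (c - (\<eta> * dist p q) *\<^sub>R e', c - (\<eta> * dist p q) *\<^sub>R e' + dist p q *\<^sub>R e'))"
  have "A \<subseteq> g ` {e, - e}"
  proof (clarify)
    fix p' q' assume p'q': "(p', q') \<in> A"
    have ne': "p \<noteq> q" "p' \<noteq> q'" using A pq p'q' by auto
    note * = apexes_three_points[OF ne' _ _ ne] A[OF pq] A[OF p'q']
    have p': "p' = c - (\<eta> * dist p q) *\<^sub>R direction p' q'"
      using * unfolding c_def e_def by (simp add: eq_diff_eq)
    moreover have "q' = p' + dist p q *\<^sub>R direction p' q'"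
      using direction_target[OF ne'(2)] * by simp
    ultimately have "(p', q') = g (direction p' q')" by (simp add: g_def)
    moreover have "direction p' q' \<in> {e, - e}" using * by (simp add: e_def)
    ultimately show "(p', q') \<in> g ` {e, - e}" by (rule image_eqI)
  qed
  then have "card A \<le> card (g ` {e, - e})" by (intro card_mono) auto
  also have "\<dots> \<le> card {e, - e}" by (rule card_image_le) simp
  also have "\<dots> \<le> 2" by (rule card_insert_le_m1[THEN order_trans]) auto
  finally show ?thesis .
qed simp

lemma card_apexes_Int_le:
  assumes "p \<noteq> q" "p \<noteq> q'" "q \<noteq> q'" "finite P"
  shows "card (apexes \<alpha> \<beta> p q \<inter> P \<inter> (apexes \<alpha> \<beta> p q' \<inter> P)) \<le> 2"
proof (rule ccontr)
  let ?X = "apexes \<alpha> \<beta> p q \<inter> P \<inter> (apexes \<alpha> \<beta> p q' \<inter> P)"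
  assume "\<not> card ?X \<le> 2"
  then have "3 \<le> card ?X" by simp
  then obtain T where T: "T \<subseteq> ?X" "card T = 3" by (rule obtain_subset_with_card_n)
  from T(2)[unfolded card_3_iff] obtain x y z where xyz: "T = {x, y, z}" "x \<noteq> y" "y \<noteq> z" "x \<noteq> z"
    by blast
  then have "{x, y, z} \<subseteq> apexes \<alpha> \<beta> p q" "{x, y, z} \<subseteq> apexes \<alpha> \<beta> p q'" using T(1) by blast+
  then have "q' = q" by (rule apexes_inj[OF assms(1,2) _ _ xyz(2,4,3)])
  then show False using assms(3) by simp
qed

lemma apexes_circle3:
  assumes "p \<noteq> q"
  obtains c u v R where "apexes \<alpha> \<beta> p q = circle3 c u v R"
proof -
  obtain u v where "orthonormal3 u v (direction p q)" by (rule exists_orthonormal3_last[OF direction_unit[OF assms]])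
  then show thesis
    using that sphere_cap_eq_circle3[of u v "direction p q" "\<alpha> * dist p q" "\<eta> * dist p q" p]
      apexes_eq_cap[OF assms] assms \<alpha> \<eta> by simp
qed

lemma card_circles_in_zero_set:
  assumes F: "pol affine_funs k F" and fin: "finite Q" and "0 < \<delta>"
    and Q: "\<And>q. q \<in> Q \<Longrightarrow> dist p q = \<delta> \<and> (\<forall>w\<in>apexes \<alpha> \<beta> p q. F w = 0)"
    and w0: "dist p w0 = \<alpha> * \<delta>" "F w0 \<noteq> 0"
  shows "int (card Q) \<le> k"
proof (rule ccontr)
  assume many: "\<not> ?thesis"
  have pq: "p \<noteq> q" if "q \<in> Q" for q using Q[OF that] assms(3) by auto
  have "inj_on (direction p) Q"
  proof (rule inj_onI)
    fix q q' assume "q \<in> Q" "q' \<in> Q" "direction p q = direction p q'"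
    then show "q = q'" using direction_target[OF pq, of q] direction_target[OF pq, of q'] Q by metis
  qed
  then have card: "card (direction p ` Q) = card Q" by (rule card_image)
  have "F w0 = 0"
  proof (rule pol_zero_on_sphere_of_caps[OF _ F, of "direction p ` Q" "\<eta> * \<delta>" "\<alpha> * \<delta>" p])
    show "finite (direction p ` Q)" using fin by simp
    show "k < int (card (direction p ` Q))" using many card by simp
    show "0 < \<eta> * \<delta>" "\<eta> * \<delta> < \<alpha> * \<delta>" using \<eta> assms(3) by simp_all
    show "dist p w0 = \<alpha> * \<delta>" by (rule w0(1))
    fix e assume "e \<in> direction p ` Q"
    then obtain q where q: "q \<in> Q" "e = direction p q" by blast
    show "inner e e = 1" using direction_unit[OF pq[OF q(1)]] q(2) by simp
    fix w assume "w \<in> sphere_cap p (\<alpha> * \<delta>) (\<eta> * \<delta>) e"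
    then have "w \<in> apexes \<alpha> \<beta> p q" using apexes_eq_cap[OF pq[OF q(1)]] Q[OF q(1)] q(2) by simp
    then show "F w = 0" using Q[OF q(1)] by blast
  qed
  then show False using w0 by simp
qed

end

section \<open>Counting incidences\<close>

definition pairs :: "'b set \<Rightarrow> ('b \<times> 'b) set" where
  "pairs P = {(p, q) \<in> P \<times> P. p \<noteq> q}"

lemma finite_pairs: "finite P \<Longrightarrow> finite (pairs P)"
  by (rule finite_subset[of _ "P \<times> P"]) (auto simp: pairs_def)

lemma card_pairs_le: "finite P \<Longrightarrow> B \<subseteq> pairs P \<Longrightarrow> card B \<le> (card P)\<^sup>2"
  using card_mono[of "P \<times> P" B] by (auto simp: pairs_def card_cartesian_product power2_eq_square)

context triangle_ratios
begin

lemma sum_transversal_circles: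
  assumes P: "finite P" and F: "pol affine_funs k F" and B: "B \<subseteq> pairs P"
    and trans: "\<And>p q. (p, q) \<in> B \<Longrightarrow> \<exists>w\<in>apexes \<alpha> \<beta> p q. F w \<noteq> 0"
  shows "(\<Sum>(p, q)\<in>B. card (apexes \<alpha> \<beta> p q \<inter> P))
    \<le> (card P)\<^sup>2 * (6 * nat k + 3) + 2 * card (triples (connected_component {w. F w \<noteq> 0}) P)"
proof -
  let ?T = "triples (connected_component {w. F w \<noteq> 0})"
  let ?in = "\<lambda>pq t. {fst t, fst (snd t), snd (snd t)} \<subseteq> apexes \<alpha> \<beta> (fst pq) (snd pq)"
  have finB: "finite B" using B finite_pairs[OF P] finite_subset by blast
  have "(\<Sum>(p, q)\<in>B. card (apexes \<alpha> \<beta> p q \<inter> P)) \<le> (\<Sum>pq\<in>B. (6 * nat k + 3) + card {t \<in> ?T P. ?in pq t})"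
    unfolding case_prod_unfold
  proof (rule sum_mono)
    fix pq' assume "pq' \<in> B"
    then obtain p q where pq: "(p, q) \<in> B" and pq': "pq' = (p, q)" by (cases pq') auto
    then have "p \<noteq> q" using B by (auto simp: pairs_def)
    then obtain c u v R where circ: "apexes \<alpha> \<beta> p q = circle3 c u v R" by (rule apexes_circle3)
    obtain w where w: "w \<in> circle3 c u v R" "F w \<noteq> 0" using trans[OF pq] circ by blast
    have "card (circle3 c u v R \<inter> P) \<le> 6 * nat k + 3 + card (?T (circle3 c u v R \<inter> P))"
      by (rule circle_points_bound[OF F w]) (use P in auto)
    moreover have "?T (circle3 c u v R \<inter> P) = {t \<in> ?T P. ?in (p, q) t}"
      by (auto simp: triples_def circ)
    ultimately show "card (apexes \<alpha> \<beta> (fst pq') (snd pq') \<inter> P) \<le> (6 * nat k + 3) + card {t \<in> ?T P. ?in pq' t}"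
      by (simp only: circ pq' fst_conv snd_conv)
  qed
  also have "\<dots> = card B * (6 * nat k + 3) + (\<Sum>pq\<in>B. card {t \<in> ?T P. ?in pq t})"
    by (subst sum.distrib) simp
  also have "(\<Sum>pq\<in>B. card {t \<in> ?T P. ?in pq t}) = (\<Sum>t\<in>?T P. card {pq \<in> B. ?in pq t})"
    by (rule sum_card_swap[OF finB finite_triples[OF P]])
  also have "\<dots> \<le> (\<Sum>t\<in>?T P. 2)"
  proof (rule sum_mono)
    fix t assume "t \<in> ?T P"
    then obtain x y z where t: "t = (x, y, z)" and ne: "x \<noteq> y" "x \<noteq> z" "y \<noteq> z" by (auto simp: triples_def)
    show "card {pq \<in> B. ?in pq t} \<le> 2"
      by (rule card_pairs_three_points[OF ne]) (use finB B in \<open>auto simp: pairs_def t\<close>)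
  qed
  also have "\<dots> = 2 * card (?T P)" by simp
  also have "card B * (6 * nat k + 3) \<le> (card P)\<^sup>2 * (6 * nat k + 3)"
    using card_pairs_le[OF P B] by (rule mult_le_mono1)
  finally show ?thesis by simp
qed

lemma sum_contained_circles_at:
  assumes P: "finite P" and F: "pol affine_funs k F" and Q: "Q \<subseteq> P"
    and inside: "\<And>q. q \<in> Q \<Longrightarrow> p \<noteq> q \<and> (\<forall>w\<in>apexes \<alpha> \<beta> p q. F w = 0) \<and>
      (\<exists>w. dist p w = \<alpha> * dist p q \<and> F w \<noteq> 0)"
  shows "(\<Sum>q\<in>Q. card (apexes \<alpha> \<beta> p q \<inter> P)) \<le> card P + 2 * nat k * card P"
proof -
  have finQ: "finite Q" using P Q finite_subset by blast
  let ?Q = "\<lambda>\<delta>. {q \<in> Q. dist p q = \<delta>}" and ?S = "\<lambda>\<delta>. {r \<in> P. dist p r = \<alpha> * \<delta>}"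
  have "(\<Sum>q\<in>Q. card (apexes \<alpha> \<beta> p q \<inter> P)) = (\<Sum>\<delta>\<in>dist p ` Q. \<Sum>q\<in>?Q \<delta>. card (apexes \<alpha> \<beta> p q \<inter> P))"
    by (rule sum.image_gen[OF finQ])
  also have "\<dots> \<le> (\<Sum>\<delta>\<in>dist p ` Q. card (?S \<delta>) + 2 * nat k * card (?Q \<delta>))"
  proof (rule sum_mono)
    fix \<delta> assume "\<delta> \<in> dist p ` Q"
    then obtain q0 where q0: "q0 \<in> Q" "\<delta> = dist p q0" by blast
    obtain w0 where w0: "dist p w0 = \<alpha> * \<delta>" "F w0 \<noteq> 0" using inside[OF q0(1)] q0(2) by blast
    have "int (card (?Q \<delta>)) \<le> k"
    proof (rule card_circles_in_zero_set[OF F _ _ _ w0])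
      show "0 < \<delta>" using inside[OF q0(1)] q0(2) by simp
    qed (use finQ inside in auto)
    then have k: "card (?Q \<delta>) \<le> nat k" by linarith
    have "(\<Sum>q\<in>?Q \<delta>. card (apexes \<alpha> \<beta> p q \<inter> P)) \<le> card (\<Union>q\<in>?Q \<delta>. apexes \<alpha> \<beta> p q \<inter> P) + 2 * (card (?Q \<delta>))\<^sup>2"
    proof (rule sum_card_almost_disjoint)
      fix q q' assume "q \<in> ?Q \<delta>" "q' \<in> ?Q \<delta>" "q \<noteq> q'"
      then show "card (apexes \<alpha> \<beta> p q \<inter> P \<inter> (apexes \<alpha> \<beta> p q' \<inter> P)) \<le> 2"
        using inside by (intro card_apexes_Int_le P) auto
    qed (use finQ P in auto)
    moreover have "card (\<Union>q\<in>?Q \<delta>. apexes \<alpha> \<beta> p q \<inter> P) \<le> card (?S \<delta>)"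
      using P by (intro card_mono) (auto simp: apexes_def)
    moreover have "(card (?Q \<delta>))\<^sup>2 \<le> nat k * card (?Q \<delta>)"
      using k by (simp add: power2_eq_square)
    ultimately show "(\<Sum>q\<in>?Q \<delta>. card (apexes \<alpha> \<beta> p q \<inter> P)) \<le> card (?S \<delta>) + 2 * nat k * card (?Q \<delta>)"
      by linarith
  qed
  also have "\<dots> = (\<Sum>\<delta>\<in>dist p ` Q. card (?S \<delta>)) + 2 * nat k * (\<Sum>\<delta>\<in>dist p ` Q. card (?Q \<delta>))"
    by (simp only: sum.distrib sum_distrib_left)
  also have "(\<Sum>\<delta>\<in>dist p ` Q. card (?S \<delta>)) = card (\<Union>\<delta>\<in>dist p ` Q. ?S \<delta>)"
    using finQ P \<alpha> by (intro card_UN_disjoint[symmetric]) auto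
  also have "\<dots> \<le> card P" using P by (intro card_mono) auto
  also have "(\<Sum>\<delta>\<in>dist p ` Q. card (?Q \<delta>)) = card (\<Union>\<delta>\<in>dist p ` Q. ?Q \<delta>)"
    using finQ by (intro card_UN_disjoint[symmetric]) auto
  also have "\<dots> \<le> card P" using P Q by (intro card_mono) auto
  finally show ?thesis by simp
qed

lemma sum_contained_circles:
  assumes P: "finite P" and F: "pol affine_funs k F" and B: "B \<subseteq> pairs P"
    and inside: "\<And>p q. (p, q) \<in> B \<Longrightarrow> (\<forall>w\<in>apexes \<alpha> \<beta> p q. F w = 0) \<and>
      (\<exists>w. dist p w = \<alpha> * dist p q \<and> F w \<noteq> 0)"
  shows "(\<Sum>(p, q)\<in>B. card (apexes \<alpha> \<beta> p q \<inter> P)) \<le> (card P)\<^sup>2 * (2 * nat k + 1)"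
proof -
  let ?Q = "\<lambda>p. {q \<in> P. (p, q) \<in> B}"
  have "B = (SIGMA p:P. ?Q p)" using B by (auto simp: pairs_def)
  then have "(\<Sum>(p, q)\<in>B. card (apexes \<alpha> \<beta> p q \<inter> P)) = (\<Sum>p\<in>P. \<Sum>q\<in>?Q p. card (apexes \<alpha> \<beta> p q \<inter> P))"
    using P by (subst sum.Sigma) auto
  also have "\<dots> \<le> (\<Sum>p\<in>P. card P + 2 * nat k * card P)"
    using B inside by (intro sum_mono sum_contained_circles_at[OF P F]) (auto simp: pairs_def)
  also have "\<dots> = (card P)\<^sup>2 * (2 * nat k + 1)"
    by (simp add: power2_eq_square algebra_simps)
  finally show ?thesis .
qed

lemma sum_contained_spheres:
  assumes P: "finite P" and F: "pol affine_funs k F" "F y \<noteq> 0" and B: "B \<subseteq> pairs P"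
    and inside: "\<And>p q w. (p, q) \<in> B \<Longrightarrow> dist p w = \<alpha> * dist p q \<Longrightarrow> F w = 0"
  shows "(\<Sum>(p, q)\<in>B. card (apexes \<alpha> \<beta> p q \<inter> P)) \<le> (card P)\<^sup>2 * nat k"
proof -
  have finB: "finite B" using B finite_pairs[OF P] finite_subset by blast
  define \<Sigma> where "\<Sigma> = (\<lambda>(p, q). (p, \<alpha> * dist p q)) ` B"
  have fin\<Sigma>: "finite \<Sigma>" using finB by (simp add: \<Sigma>_def)
  have "\<not> k < 2 * int (card \<Sigma>)"
  proof
    assume "k < 2 * int (card \<Sigma>)"
    then have "F y = 0"
      by (rule pol_zero_of_spheres[OF fin\<Sigma> F(1)]) (use inside B \<alpha> in \<open>auto simp: \<Sigma>_def pairs_def\<close>)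
    then show False using F(2) by simp
  qed
  then have card\<Sigma>: "card \<Sigma> \<le> nat k" by linarith
  have "inj_on (\<lambda>(p, q). ((p, \<alpha> * dist p q), q)) B" by (auto intro: inj_onI)
  moreover have "(\<lambda>(p, q). ((p, \<alpha> * dist p q), q)) ` B \<subseteq> \<Sigma> \<times> P"
    using B by (auto simp: \<Sigma>_def pairs_def)
  ultimately have "card B \<le> card (\<Sigma> \<times> P)"
    using card_inj_on_le fin\<Sigma> P by blast
  also have "\<dots> \<le> nat k * card P" using card\<Sigma> by (simp add: card_cartesian_product)
  finally have cardB: "card B \<le> nat k * card P" .
  have "(\<Sum>(p, q)\<in>B. card (apexes \<alpha> \<beta> p q \<inter> P)) \<le> (\<Sum>(p, q)\<in>B. card P)"
    using P by (intro sum_mono) (auto intro: card_mono)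
  also have "\<dots> = card B * card P" by (simp add: case_prod_unfold)
  also have "\<dots> \<le> nat k * card P * card P" using cardB by (rule mult_le_mono1)
  finally show ?thesis by (simp add: power2_eq_square mult_ac)
qed

lemma card_connected_triples_le:
  assumes P: "finite P" and "0 \<le> \<tau>"
    and cell: "\<And>A. connected A \<Longrightarrow> \<forall>y\<in>A. F y \<noteq> 0 \<Longrightarrow> real (card (A \<inter> P)) \<le> \<tau>"
  shows "real (card (triples (connected_component {w. F w \<noteq> 0}) P)) \<le> real (card P) * \<tau>\<^sup>2"
proof -
  let ?C = "\<lambda>x. connected_component_set {w. F w \<noteq> 0} x \<inter> P"
  have "triples (connected_component {w. F w \<noteq> 0}) P \<subseteq> (SIGMA x:P. ?C x \<times> ?C x)"
    by (auto simp: triples_def)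
  then have "card (triples (connected_component {w. F w \<noteq> 0}) P) \<le> card (SIGMA x:P. ?C x \<times> ?C x)"
    using P by (intro card_mono) auto
  also have "\<dots> = (\<Sum>x\<in>P. (card (?C x))\<^sup>2)"
    using P by (subst card_SigmaI) (auto simp: card_cartesian_product power2_eq_square)
  finally have "real (card (triples (connected_component {w. F w \<noteq> 0}) P)) \<le> (\<Sum>x\<in>P. (real (card (?C x)))\<^sup>2)"
    by (simp flip: of_nat_power of_nat_sum)
  also have "\<dots> \<le> (\<Sum>x\<in>P. \<tau>\<^sup>2)"
  proof (intro sum_mono power_mono)
    fix x
    show "real (card (?C x)) \<le> \<tau>" by (rule cell) (auto dest: connected_component_in)
  qed simp
  finally show ?thesis by simp
qed

lemma sum_apexes_le:
  assumes P: "finite P" and F: "pol affine_funs k F" "\<exists>y. F y \<noteq> 0" and "0 \<le> \<tau>"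
    and cell: "\<And>A. connected A \<Longrightarrow> \<forall>y\<in>A. F y \<noteq> 0 \<Longrightarrow> real (card (A \<inter> P)) \<le> \<tau>"
  shows "real (\<Sum>(p, q)\<in>pairs P. card (apexes \<alpha> \<beta> p q \<inter> P))
    \<le> (real (card P))\<^sup>2 * (9 * real (nat k) + 4) + 2 * real (card P) * \<tau>\<^sup>2"
proof -
  let ?f = "\<lambda>(p, q). card (apexes \<alpha> \<beta> p q \<inter> P)"
  define B1 where "B1 = {(p, q) \<in> pairs P. \<exists>w\<in>apexes \<alpha> \<beta> p q. F w \<noteq> 0}"
  define B2 where "B2 = {(p, q) \<in> pairs P. (\<forall>w\<in>apexes \<alpha> \<beta> p q. F w = 0) \<and> (\<exists>w. dist p w = \<alpha> * dist p q \<and> F w \<noteq> 0)}"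
  define B3 where "B3 = {(p, q) \<in> pairs P. \<forall>w. dist p w = \<alpha> * dist p q \<longrightarrow> F w = 0}"
  have fin: "finite B1" "finite B2" "finite B3"
    using finite_pairs[OF P] by (auto simp: B1_def B2_def B3_def intro: finite_subset)
  have "sum ?f (pairs P) \<le> sum ?f (B1 \<union> (B2 \<union> B3))"
    using fin by (intro sum_mono2) (auto simp: B1_def B2_def B3_def)
  also have "\<dots> \<le> sum ?f B1 + (sum ?f B2 + sum ?f B3)"
    using sum.union_inter[of B1 "B2 \<union> B3" ?f] sum.union_inter[of B2 B3 ?f] fin by simp
  finally have "sum ?f (pairs P) \<le> sum ?f B1 + (sum ?f B2 + sum ?f B3)" .
  moreover have "sum ?f B1 \<le> (card P)\<^sup>2 * (6 * nat k + 3) + 2 * card (triples (connected_component {w. F w \<noteq> 0}) P)"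
    by (rule sum_transversal_circles[OF P F(1)]) (auto simp: B1_def)
  moreover have "sum ?f B2 \<le> (card P)\<^sup>2 * (2 * nat k + 1)"
    by (rule sum_contained_circles[OF P F(1)]) (auto simp: B2_def)
  moreover obtain y where y: "F y \<noteq> 0" using F(2) by blast
  have "sum ?f B3 \<le> (card P)\<^sup>2 * nat k"
    by (rule sum_contained_spheres[OF P F(1) y]) (auto simp: B3_def)
  ultimately have "sum ?f (pairs P) \<le> (card P)\<^sup>2 * (6 * nat k + 3) + 2 * card (triples (connected_component {w. F w \<noteq> 0}) P)
      + ((card P)\<^sup>2 * (2 * nat k + 1) + (card P)\<^sup>2 * nat k)"
    by linarith
  also have "\<dots> = (card P)\<^sup>2 * (9 * nat k + 4) + 2 * card (triples (connected_component {w. F w \<noteq> 0}) P)"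
    by (simp add: algebra_simps)
  finally have "real (sum ?f (pairs P)) \<le> real ((card P)\<^sup>2 * (9 * nat k + 4) + 2 * card (triples (connected_component {w. F w \<noteq> 0}) P))"
    by (simp only: of_nat_le_iff)
  also have "\<dots> = (real (card P))\<^sup>2 * (9 * real (nat k) + 4) + 2 * real (card (triples (connected_component {w. F w \<noteq> 0}) P))"
    by simp
  also have "\<dots> \<le> (real (card P))\<^sup>2 * (9 * real (nat k) + 4) + 2 * (real (card P) * \<tau>\<^sup>2)"
    using card_connected_triples_le[OF P assms(4), of F] cell by simp
  finally show ?thesis by simp
qed

lemma sum_apexes_powr_bound:
  assumes P: "finite P"
  shows "real (\<Sum>(p, q)\<in>pairs P. card (apexes \<alpha> \<beta> p q \<inter> P)) \<le> 6000 * real (card P) powr (15 / 7)"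
proof (cases "P = {}")
  case True
  then show ?thesis by (simp add: pairs_def)
next
  case False
  define n where "n = real (card P)"
  have n: "1 \<le> n" using False P by (simp add: n_def Suc_le_eq card_gt_0_iff)
  have "\<exists>j. 2 ^ j \<le> n powr (3 / 7) \<and> n powr (3 / 7) < 2 ^ Suc j"
  proof -
    define x where "x = n powr (3 / 7)"
    have x: "1 \<le> x" using n by (simp add: x_def ge_one_powr_ge_zero)
    obtain m where m: "x < 2 ^ m" using real_arch_pow[of 2 x] by auto
    define i where "i = (LEAST m. x < 2 ^ m)"
    have i: "x < 2 ^ i" unfolding i_def by (rule LeastI[of _ m]) (rule m)
    then have "i \<noteq> 0" using x by (cases i) auto
    then obtain j where j: "i = Suc j" by (cases i) auto
    have "\<not> x < 2 ^ j" using not_less_Least[of j "\<lambda>m. x < 2 ^ m"] j by (simp add: i_def)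
    then show ?thesis using i j by (intro exI[of _ j]) (simp add: x_def)
  qed
  then obtain j where j: "2 ^ j \<le> n powr (3 / 7)" "n powr (3 / 7) < 2 ^ Suc j" by blast
  obtain k F where F: "0 \<le> k" "real_of_int k \<le> 640 * root 3 (2 ^ j)" "pol affine_funs k F" "\<exists>y. F y \<noteq> 0"
    "\<And>A. connected A \<Longrightarrow> \<forall>y\<in>A. F y \<noteq> 0 \<Longrightarrow> card (A \<inter> P) * 2 ^ j \<le> card P"
    using polynomial_partition[OF P, of j] by blast
  have "root 3 (2 ^ j) \<le> root 3 (n powr (3 / 7))" using j(1) by simp
  also have "\<dots> = n powr (1 / 7)" using n by (simp add: root_powr_inverse powr_powr)
  finally have k: "real (nat k) \<le> 640 * n powr (1 / 7)" using F(1,2) by simp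
  have cell: "real (card (A \<inter> P)) \<le> 2 * n powr (4 / 7)" if "connected A" "\<forall>y\<in>A. F y \<noteq> 0" for A
  proof -
    have "real (card (A \<inter> P) * 2 ^ j) \<le> n"
      unfolding n_def using F(5)[OF that] by (simp only: of_nat_le_iff)
    then have "real (card (A \<inter> P)) * (2 * 2 ^ j) \<le> 2 * n" by simp
    moreover have "real (card (A \<inter> P)) * n powr (3 / 7) \<le> real (card (A \<inter> P)) * (2 * 2 ^ j)"
      using j(2) by (intro mult_left_mono) auto
    ultimately have "real (card (A \<inter> P)) * n powr (3 / 7) \<le> 2 * n" by linarith
    also have "2 * n = (2 * n powr (4 / 7)) * n powr (3 / 7)" using n by (simp flip: powr_add)
    finally show ?thesis using n by simp
  qed
  have "real (\<Sum>(p, q)\<in>pairs P. card (apexes \<alpha> \<beta> p q \<inter> P))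
      \<le> n\<^sup>2 * (9 * real (nat k) + 4) + 2 * n * (2 * n powr (4 / 7))\<^sup>2"
    unfolding n_def by (rule sum_apexes_le[OF P F(3,4)]) (use cell in \<open>auto simp: n_def\<close>)
  also have "n\<^sup>2 * (9 * real (nat k) + 4) \<le> n\<^sup>2 * (5764 * n powr (1 / 7))"
    using k n ge_one_powr_ge_zero[of n "1 / 7"] by (intro mult_left_mono) auto
  also have "n\<^sup>2 * (5764 * n powr (1 / 7)) = 5764 * n powr (15 / 7)"
    using n by (simp add: powr_add[of n 2 "1 / 7", simplified])
  also have "2 * n * (2 * n powr (4 / 7))\<^sup>2 = 8 * n powr (15 / 7)"
  proof -
    have "n * (n powr (4 / 7))\<^sup>2 = n powr 1 * (n powr (4 / 7) * n powr (4 / 7))"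
      using n by (simp add: power2_eq_square)
    also have "\<dots> = n powr (15 / 7)" by (simp only: powr_add[symmetric]) simp
    finally show ?thesis by (simp add: power_mult_distrib)
  qed
  finally show ?thesis using powr_ge_zero[of n "15 / 7"] unfolding n_def by linarith
qed

end

section \<open>Similar triangles\<close>

lemma noncollinear_triangle_inequality:
  fixes a b c :: "'a::euclidean_space"
  assumes "\<not> collinear {a, b, c}"
  shows "dist a b < dist a c + dist c b"
proof -
  have "dist a b \<noteq> dist a c + dist c b"
  proof
    assume "dist a b = dist a c + dist c b"
    then have "between (a, b) c" by (simp add: between)
    then have "collinear {a, c, b}" by (rule between_imp_collinear)
    then show False using assms by (simp add: insert_commute)
  qed
  then show ?thesis using dist_triangle[of a b c] by linarith
qed

lemma triangle_ratios_of_triangle: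
  fixes a b c :: "real^3"
  assumes tri: "\<not> collinear {a, b, c}" and ord: "dist b c \<le> dist a c"
  shows "triangle_ratios (dist a c / dist a b) (dist b c / dist a b)
    (((dist a c / dist a b)\<^sup>2 - (dist b c / dist a b)\<^sup>2 + 1) / 2)"
proof
  define l where "l = dist a c / dist a b"
  define m where "m = dist b c / dist a b"
  have ne: "a \<noteq> b" "a \<noteq> c" "b \<noteq> c" using tri by (auto simp: insert_commute)
  have "dist a c < dist a b + dist b c"
    using noncollinear_triangle_inequality[of a c b] tri by (simp add: insert_commute)
  then have "l < 1 + m" using ne by (simp add: l_def m_def field_simps)
  have "dist a b < dist a c + dist b c"
    using noncollinear_triangle_inequality[of a b c] tri by (simp add: dist_commute)
  then have "1 < l + m" using ne by (simp add: l_def m_def field_simps)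
  show lm: "0 < dist a c / dist a b" "0 < dist b c / dist a b" using ne by simp_all
  have "m \<le> l" using ord by (simp add: l_def m_def divide_right_mono)
  then have "m\<^sup>2 \<le> l\<^sup>2" using lm by (intro power_mono) (auto simp: m_def)
  then show "0 < ((dist a c / dist a b)\<^sup>2 - (dist b c / dist a b)\<^sup>2 + 1) / 2"
    unfolding l_def[symmetric] m_def[symmetric] by simp
  have "\<bar>l - 1\<bar> < m" using \<open>l < 1 + m\<close> \<open>1 < l + m\<close> by linarith
  then have "(l - 1)\<^sup>2 < m\<^sup>2" by (metis abs_ge_zero power2_abs power_strict_mono zero_less_numeral)
  then show "((dist a c / dist a b)\<^sup>2 - (dist b c / dist a b)\<^sup>2 + 1) / 2 < dist a c / dist a b"
    unfolding l_def[symmetric] m_def[symmetric] by (simp add: power2_eq_square algebra_simps)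
qed (rule refl)

lemma num_similar_triangles_le_sum_apexes:
  fixes a b c :: "real^3"
  assumes P: "finite P" and tri: "\<not> collinear {a, b, c}"
  shows "num_similar_triangles {a, b, c} P
    \<le> (\<Sum>(p, q)\<in>pairs P. card (apexes (dist a c / dist a b) (dist b c / dist a b) p q \<inter> P))"
proof -
  let ?A = "\<lambda>(p, q). apexes (dist a c / dist a b) (dist b c / dist a b) p q \<inter> P"
  have ne: "a \<noteq> b" using tri by auto
  have fin: "finite (SIGMA pq:pairs P. ?A pq)"
    using P finite_pairs[OF P] by (intro finite_SigmaI) auto
  have "{T. T \<subseteq> P \<and> is_triangle T \<and> similar {a, b, c} T} \<subseteq> (\<lambda>((p, q), r). {p, q, r}) ` (SIGMA pq:pairs P. ?A pq)"
  proof
    fix T assume T: "T \<in> {T. T \<subseteq> P \<and> is_triangle T \<and> similar {a, b, c} T}"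
    then obtain f s where s: "0 < s" "\<And>x y. dist (f x) (f y) = s * dist x y" and f: "f ` {a, b, c} = T"
      by (auto simp: similar_def similarity_def)
    have "((f a, f b), f c) \<in> (SIGMA pq:pairs P. ?A pq)"
    proof -
      have in_P: "f a \<in> P" "f b \<in> P" "f c \<in> P" using T f by auto
      have "0 < dist (f a) (f b)" using s ne by simp
      then have "f a \<noteq> f b" by auto
      then show ?thesis using in_P ne by (simp add: pairs_def apexes_def s(2))
    qed
    moreover have "T = (\<lambda>((p, q), r). {p, q, r}) ((f a, f b), f c)" using f by auto
    ultimately show "T \<in> (\<lambda>((p, q), r). {p, q, r}) ` (SIGMA pq:pairs P. ?A pq)" by (rule rev_image_eqI)
  qed
  then have "num_similar_triangles {a, b, c} P \<le> card ((\<lambda>((p, q), r). {p, q, r}) ` (SIGMA pq:pairs P. ?A pq))"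
    unfolding num_similar_triangles_def using fin by (intro card_mono) auto
  also have "\<dots> \<le> card (SIGMA pq:pairs P. ?A pq)" by (rule card_image_le[OF fin])
  also have "\<dots> = (\<Sum>pq\<in>pairs P. card (?A pq))"
    using P finite_pairs[OF P] by (intro card_SigmaI) auto
  finally show ?thesis by (simp add: case_prod_unfold)
qed

lemma num_similar_triangles_bound:
  fixes a b c :: "real^3"
  assumes P: "finite P" and tri: "\<not> collinear {a, b, c}"
  shows "real (num_similar_triangles {a, b, c} P) \<le> 6000 * real (card P) powr (15 / 7)"
proof -
  have main: "real (num_similar_triangles {a, b, c} P) \<le> 6000 * real (card P) powr (15 / 7)"
    if "\<not> collinear {a, b, c}" "dist b c \<le> dist a c" for a b c :: "real^3"
  proof -
    interpret triangle_ratios "dist a c / dist a b" "dist b c / dist a b"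
      "((dist a c / dist a b)\<^sup>2 - (dist b c / dist a b)\<^sup>2 + 1) / 2"
      by (rule triangle_ratios_of_triangle[OF that])
    have "real (num_similar_triangles {a, b, c} P)
        \<le> real (\<Sum>(p, q)\<in>pairs P. card (apexes (dist a c / dist a b) (dist b c / dist a b) p q \<inter> P))"
      using num_similar_triangles_le_sum_apexes[OF P that(1)] by (simp only: of_nat_le_iff)
    also note sum_apexes_powr_bound[OF P]
    finally show ?thesis .
  qed
  show ?thesis
  proof (cases "dist b c \<le> dist a c")
    case True
    then show ?thesis using main tri by blast
  next
    case False
    then show ?thesis using main[of b a c] tri by (simp add: insert_commute)
  qed
qed

theorem theorem3p1:
  "\<exists>C>0. \<forall>(P :: (real ^ 3) set) (n :: nat) (a :: real ^ 3) (b :: real ^ 3) (c :: real ^ 3).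
     finite P \<and> card P = n \<and> is_triangle {a, b, c} \<longrightarrow>
       real (num_similar_triangles {a, b, c} P) \<le> C * real n powr (15 / 7)"
proof (intro exI[of _ 6000] conjI allI impI)
  fix P :: "(real ^ 3) set" and n :: nat and a b c :: "real ^ 3"
  assume *: "finite P \<and> card P = n \<and> is_triangle {a, b, c}"
  then have "\<not> collinear {a, b, c}" by (auto simp: is_triangle_def)
  then show "real (num_similar_triangles {a, b, c} P) \<le> 6000 * real n powr (15 / 7)"
    using * num_similar_triangles_bound[of P a b c] by simp
qed simp

end
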